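(* Let $\mathscr{C}=(S,V_1,V_2,\Pi_1,\Pi_2,\langle\,,\,\rangle)$ be a Coxeter datum with associated Coxeter system $(W,R)$, root systems $\Phi_1,\Phi_2$, and $W$-equivariant bijection $\phi\colon\Phi_1\to\Phi_2$. Let $W'$ be a reflection subgroup of $W$ and suppose that $x,y\in\Delta_1(W')$ with $r_x\ne r_y$. Let $n=\mathrm{ord}(r_xr_y)\in\mathbb{N}\cup\{\infty\}$ be the order of $r_xr_y$. Then $\langle x,\phi(y)\rangle\le 0$, and $$\langle x,\phi(y)\rangle\langle y,\phi(x)\rangle=\cos^2\tfrac{\pi}{n}\ \text{ if } n\in\mathbb{N},\ n\ge 2,\qquad \langle x,\phi(y)\rangle\langle y,\phi(x)\rangle\in[1,\infty)\ \text{ if } n=\infty.$$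
   Context: For a subset $A$ of a real vector space, $\mathrm{PLC}(A)$ is the set of all (finite) linear combinations $\sum_{a\in A}c_a a$ with all $c_a\ge 0$ and at least one $c_{a'}>0$. Coxeter datum: $V_1,V_2$ are real vector spaces with a bilinear pairing $\langle\,,\,\rangle\colon V_1\times V_2\to\mathbb{R}$, $S$ is an indexing set, and $\Pi_1=\{\alpha_s\mid s\in S\}\subseteq V_1$, $\Pi_2=\{\beta_s\mid s\in S\}\subseteq V_2$ are in bijection with $S$, such that: $\langle\alpha_s,\beta_s\rangle=1$ for all $s$; $0\notin\mathrm{PLC}(\Pi_i)$ for $i=1,2$, and $\alpha_s\notin\mathrm{PLC}(\Pi_1\setminus\{\alpha_s\})$, $\beta_s\notin\mathrm{PLC}(\Pi_2\setminus\{\beta_s\})$ for all $s$; for $s\ne t$, $\langle\alpha_s,\beta_t\rangle\le 0$; $\langle\alpha_s,\beta_t\rangle=0$ iff $\langle\alpha_t,\beta_s\rangle=0$; and for $s\neq t$ either $\langle\alpha_s,\beta_t\rangle\langle\alpha_t,\beta_s\rangle=\cos^2(\pi/m_{st})$ for some integer $m_{st}\ge2$, or this product is $\ge 1$ (then $m_{st}=\infty$). $(W,R)$ is the Coxeter system with $R=\{r_s\mid s\in S\}$ and $r_sr_t$ of order $m_{st}$ for $s\ne t$. $W$ acts faithfully on $V_1$ and $V_2$ with $r_sx=x-2\langle x,\beta_s\rangle\alpha_s$ ($x\in V_1$) and $r_sy=y-2\langle\alpha_s,y\rangle\beta_s$ ($y\in V_2$), and the pairing is $W$-invariant. For $i\in\{1,2\}$: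 $\Phi_i=W\Pi_i$, $\Phi_i^+=\Phi_i\cap\mathrm{PLC}(\Pi_i)$, $\Phi_i^-=-\Phi_i^+$, and $\Phi_i=\Phi_i^+\uplus\Phi_i^-$. There is a $W$-equivariant bijection $\phi\colon\Phi_1\to\Phi_2$ with $\phi(\alpha_s)=\beta_s$ for all $s\in S$. $T=\bigcup_{w\in W}wRw^{-1}$ is the set of reflections. For $x\in\Phi_1$, $x=w\alpha_s$ (resp. $x\in\Phi_2$, $x=w\beta_s$), put $r_x=wr_sw^{-1}\in T$ (well defined). A reflection subgroup of $W$ is a subgroup $W'$ with $W'=\langle W'\cap T\rangle$. $\ell\colon W\to\mathbb{N}$ is the length function of $(W,R)$; $\overline N(w)=\{t\in T\mid\ell(wt)<\ell(w)\}$ for $w\in W$. For a reflection subgroup $W'$: $S(W')=\{t\in T\mid\overline N(t)\cap W'=\{t\}\}$ and $\Delta_i(W')=\{x\in\Phi_i^+\mid r_x\in S(W')\}$. *)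

theory Defs
  imports
    "HOL-Analysis.Analysis"
    "HOL-Algebra.Algebra"
    "HOL-Library.Extended_Nat"
begin

definition PLC :: "'v::real_vector set \<Rightarrow> 'v set" where
  "PLC A = {v. \<exists>F c. finite F \<and> F \<subseteq> A \<and> (\<forall>a\<in>F. 0 \<le> c a) \<and> (\<exists>a\<in>F. 0 < c a)
                 \<and> v = (\<Sum>a\<in>F. c a *\<^sub>R a)}"

text \<open>
  The two vector spaces are the types \<open>'v1\<close> and \<open>'v2\<close>. The index set \<open>S\<close> and the spaces may be
  infinite (dimensional).
\<close>

locale coxeter_datum =
  fixes S :: "'s set"
    and \<alpha> :: "'s \<Rightarrow> 'v1::real_vector"
    and \<beta> :: "'s \<Rightarrow> 'v2::real_vector"
    and B :: "'v1 \<Rightarrow> 'v2 \<Rightarrow> real"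
  assumes linear_left: "\<And>y. linear (\<lambda>x. B x y)"
    and linear_right: "\<And>x. linear (\<lambda>y. B x y)"
    and inj_alpha: "inj_on \<alpha> S"
    and inj_beta: "inj_on \<beta> S"
    and pairing_self: "\<And>s. s \<in> S \<Longrightarrow> B (\<alpha> s) (\<beta> s) = 1"
    and zero_notin_PLC_alpha: "0 \<notin> PLC (\<alpha> ` S)"
    and zero_notin_PLC_beta: "0 \<notin> PLC (\<beta> ` S)"
    and alpha_notin_PLC: "\<And>s. s \<in> S \<Longrightarrow> \<alpha> s \<notin> PLC (\<alpha> ` S - {\<alpha> s})"
    and beta_notin_PLC: "\<And>s. s \<in> S \<Longrightarrow> \<beta> s \<notin> PLC (\<beta> ` S - {\<beta> s})"
    and pairing_nonpos: "\<And>s t. s \<in> S \<Longrightarrow> t \<in> S \<Longrightarrow> s \<noteq> t \<Longrightarrow> B (\<alpha> s) (\<beta> t) \<le> 0"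
    and pairing_zero_iff:
      "\<And>s t. s \<in> S \<Longrightarrow> t \<in> S \<Longrightarrow> s \<noteq> t \<Longrightarrow> B (\<alpha> s) (\<beta> t) = 0 \<longleftrightarrow> B (\<alpha> t) (\<beta> s) = 0"
    and pairing_product:
      "\<And>s t. s \<in> S \<Longrightarrow> t \<in> S \<Longrightarrow> s \<noteq> t \<Longrightarrow>
         (\<exists>m::nat. m \<ge> 2 \<and> B (\<alpha> s) (\<beta> t) * B (\<alpha> t) (\<beta> s) = (cos (pi / real m))\<^sup>2)
         \<or> B (\<alpha> s) (\<beta> t) * B (\<alpha> t) (\<beta> s) \<ge> 1"

text \<open>
  The Coxeter matrix of a datum. The \<open>THE\<close> is well defined because \<open>cos\<^sup>2 (\<pi>/m)\<close> is strictly
  increasing in \<open>m \<ge> 2\<close>; all these values are below \<open>1\<close>, so the last case is product \<open>\<ge> 1\<close>.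
\<close>

definition datum_matrix ::
  "('s \<Rightarrow> 'v1) \<Rightarrow> ('s \<Rightarrow> 'v2) \<Rightarrow> ('v1 \<Rightarrow> 'v2 \<Rightarrow> real) \<Rightarrow> 's \<Rightarrow> 's \<Rightarrow> enat" where
  "datum_matrix \<alpha> \<beta> B s t =
     (if s = t then 1
      else if \<exists>m::nat. m \<ge> 2 \<and> B (\<alpha> s) (\<beta> t) * B (\<alpha> t) (\<beta> s) = (cos (pi / real m))\<^sup>2
      then enat (THE m::nat. m \<ge> 2 \<and> B (\<alpha> s) (\<beta> t) * B (\<alpha> t) (\<beta> s) = (cos (pi / real m))\<^sup>2)
      else \<infinity>)"

text \<open>
  Coxeter systems are given by the Coxeter presentation
  \<open>\<langle>r\<^sub>s (s \<in> S) | (r\<^sub>s r\<^sub>t)\<^bsup>M s t\<^esup> = 1 whenever M s t < \<infinity>\<rangle>\<close>.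
  Since \<open>M s s = 1\<close>, the relations include \<open>r\<^sub>s\<^sup>2 = 1\<close>, so it suffices to use words in the
  generators without formal inverses.
\<close>

inductive coxeter_congruence :: "'s set \<Rightarrow> ('s \<Rightarrow> 's \<Rightarrow> enat) \<Rightarrow> 's list \<Rightarrow> 's list \<Rightarrow> bool"
  for S M where
  relation: "\<lbrakk>s \<in> S; t \<in> S; M s t = enat k; u \<in> lists S; v \<in> lists S\<rbrakk> \<Longrightarrow>
      coxeter_congruence S M (u @ concat (replicate k [s, t]) @ v) (u @ v)"
| refl: "u \<in> lists S \<Longrightarrow> coxeter_congruence S M u u"
| sym: "coxeter_congruence S M u v \<Longrightarrow> coxeter_congruence S M v u"
| trans: "coxeter_congruence S M u v \<Longrightarrow> coxeter_congruence S M v w \<Longrightarrow> coxeter_congruence S M u w"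

definition word_value :: "('w, 'm) monoid_scheme \<Rightarrow> ('s \<Rightarrow> 'w) \<Rightarrow> 's list \<Rightarrow> 'w" where
  "word_value W r u = foldr (\<lambda>s g. r s \<otimes>\<^bsub>W\<^esub> g) u \<one>\<^bsub>W\<^esub>"

locale coxeter_system = group W for W (structure) +
  fixes S :: "'s set" and M :: "'s \<Rightarrow> 's \<Rightarrow> enat" and r :: "'s \<Rightarrow> 'a"
  assumes r_closed: "r \<in> S \<rightarrow> carrier W"
    and r_generate: "generate W (r ` S) = carrier W"
    and presentation: "\<And>u v. u \<in> lists S \<Longrightarrow> v \<in> lists S \<Longrightarrow>
          word_value W r u = word_value W r v \<longleftrightarrow> coxeter_congruence S M u v"

definition cox_length :: "('w, 'm) monoid_scheme \<Rightarrow> 's set \<Rightarrow> ('s \<Rightarrow> 'w) \<Rightarrow> 'w \<Rightarrow> nat" where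
  "cox_length W S r w = (LEAST n. \<exists>u\<in>lists S. length u = n \<and> word_value W r u = w)"

definition reflections :: "('w, 'm) monoid_scheme \<Rightarrow> 's set \<Rightarrow> ('s \<Rightarrow> 'w) \<Rightarrow> 'w set" where
  "reflections W S r = {w \<otimes>\<^bsub>W\<^esub> r s \<otimes>\<^bsub>W\<^esub> inv\<^bsub>W\<^esub> w | w s. w \<in> carrier W \<and> s \<in> S}"

definition reflection_subgroup ::
  "('w, 'm) monoid_scheme \<Rightarrow> 's set \<Rightarrow> ('s \<Rightarrow> 'w) \<Rightarrow> 'w set \<Rightarrow> bool" where
  "reflection_subgroup W S r W' \<longleftrightarrow>
     subgroup W' W \<and> W' = generate W (W' \<inter> reflections W S r)"

definition Nbar :: "('w, 'm) monoid_scheme \<Rightarrow> 's set \<Rightarrow> ('s \<Rightarrow> 'w) \<Rightarrow> 'w \<Rightarrow> 'w set" where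
  "Nbar W S r w =
     {t \<in> reflections W S r. cox_length W S r (w \<otimes>\<^bsub>W\<^esub> t) < cox_length W S r w}"

definition canonical_generators ::
  "('w, 'm) monoid_scheme \<Rightarrow> 's set \<Rightarrow> ('s \<Rightarrow> 'w) \<Rightarrow> 'w set \<Rightarrow> 'w set" where
  "canonical_generators W S r W' = {t \<in> reflections W S r. Nbar W S r t \<inter> W' = {t}}"

text \<open>
  Below, \<open>act\<close> is the action of \<open>W\<close> on one of the two spaces and \<open>\<gamma>\<close> the corresponding family
  of simple roots (\<open>\<alpha>\<close> or \<open>\<beta>\<close>).
\<close>

definition roots ::
  "('w, 'm) monoid_scheme \<Rightarrow> 's set \<Rightarrow> ('w \<Rightarrow> 'v \<Rightarrow> 'v) \<Rightarrow> ('s \<Rightarrow> 'v) \<Rightarrow> 'v set" where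
  "roots W S act \<gamma> = {act w (\<gamma> s) | w s. w \<in> carrier W \<and> s \<in> S}"

definition positive_roots ::
  "('w, 'm) monoid_scheme \<Rightarrow> 's set \<Rightarrow> ('w \<Rightarrow> 'v \<Rightarrow> 'v) \<Rightarrow> ('s \<Rightarrow> 'v::real_vector) \<Rightarrow> 'v set" where
  "positive_roots W S act \<gamma> = roots W S act \<gamma> \<inter> PLC (\<gamma> ` S)"

definition root_reflection ::
  "('w, 'm) monoid_scheme \<Rightarrow> 's set \<Rightarrow> ('s \<Rightarrow> 'w) \<Rightarrow> ('w \<Rightarrow> 'v \<Rightarrow> 'v) \<Rightarrow> ('s \<Rightarrow> 'v) \<Rightarrow> 'v \<Rightarrow> 'w" where
  "root_reflection W S r act \<gamma> x =
     (THE t. \<exists>w\<in>carrier W. \<exists>s\<in>S. x = act w (\<gamma> s) \<and> t = w \<otimes>\<^bsub>W\<^esub> r s \<otimes>\<^bsub>W\<^esub> inv\<^bsub>W\<^esub> w)"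

definition canonical_roots ::
  "('w, 'm) monoid_scheme \<Rightarrow> 's set \<Rightarrow> ('s \<Rightarrow> 'w) \<Rightarrow> ('w \<Rightarrow> 'v \<Rightarrow> 'v) \<Rightarrow>
   ('s \<Rightarrow> 'v::real_vector) \<Rightarrow> 'w set \<Rightarrow> 'v set" where
  "canonical_roots W S r act \<gamma> W' =
     {x \<in> positive_roots W S act \<gamma>.
        root_reflection W S r act \<gamma> x \<in> canonical_generators W S r W'}"

text \<open>
  A Coxeter datum with its Coxeter system \<open>(W, R)\<close>, \<open>R = r ` S\<close>, the actions of \<open>W\<close> on both
  spaces, and the bijection \<open>\<phi>\<close>. The actions and \<open>\<phi>\<close> (on \<open>\<Phi>\<^sub>1\<close>) are uniquely determined by the
  conditions below. Faithfulness of the actions, invariance of the pairing, and the decomposition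
  of the root systems into positive and negative roots are consequences and not assumed.
\<close>

locale coxeter_realization =
  coxeter_datum S \<alpha> \<beta> B +
  coxeter_system W S "datum_matrix \<alpha> \<beta> B" r +
  V1: group_action W "UNIV :: 'v1 set" act1 +
  V2: group_action W "UNIV :: 'v2 set" act2
  for S :: "'s set"
    and \<alpha> :: "'s \<Rightarrow> 'v1::real_vector"
    and \<beta> :: "'s \<Rightarrow> 'v2::real_vector"
    and B :: "'v1 \<Rightarrow> 'v2 \<Rightarrow> real"
    and W :: "('w, 'm) monoid_scheme"
    and r :: "'s \<Rightarrow> 'w"
    and act1 :: "'w \<Rightarrow> 'v1 \<Rightarrow> 'v1"
    and act2 :: "'w \<Rightarrow> 'v2 \<Rightarrow> 'v2" +
  fixes \<phi> :: "'v1 \<Rightarrow> 'v2"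
  assumes act1_simple: "\<And>s x. s \<in> S \<Longrightarrow> act1 (r s) x = x - (2 * B x (\<beta> s)) *\<^sub>R \<alpha> s"
    and act2_simple: "\<And>s y. s \<in> S \<Longrightarrow> act2 (r s) y = y - (2 * B (\<alpha> s) y) *\<^sub>R \<beta> s"
    and phi_bij: "bij_betw \<phi> (roots W S act1 \<alpha>) (roots W S act2 \<beta>)"
    and phi_equivariant:
      "\<And>w x. w \<in> carrier W \<Longrightarrow> x \<in> roots W S act1 \<alpha> \<Longrightarrow> \<phi> (act1 w x) = act2 w (\<phi> x)"
    and phi_simple: "\<And>s. s \<in> S \<Longrightarrow> \<phi> (\<alpha> s) = \<beta> s"

end

theory Submission
  imports Defs
begin

text \<open>
  As \<open>x\<close> and \<open>y\<close> are canonical roots of the same subgroup, the reflections \<open>\<rho> = r\<^sub>x\<close> and \<open>\<sigma> = r\<^sub>y\<close> map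
  each positive root of that subgroup to a positive root, unless it is proportional to \<open>x\<close> or \<open>y\<close>,
  respectively. If \<open>\<langle>x, \<phi> y\<rangle>\<close> were positive, then \<open>\<sigma> x\<close>, \<open>\<rho> y\<close>, \<open>\<rho> \<sigma> x\<close> could not all be positive.
  For the product, apply \<open>\<sigma>, \<rho>, \<sigma>, \<dots>\<close> in turn to \<open>x\<close>: the result stays positive until a braid
  relation between \<open>\<rho>\<close> and \<open>\<sigma>\<close> occurs. In the plane spanned by \<open>x\<close> and a rescaled \<open>y\<close>, the roots
  \<open>x\<close>, \<open>\<sigma> x\<close>, \<open>\<rho> \<sigma> x\<close>, \<open>\<sigma> \<rho> \<sigma> x\<close>, \<open>\<dots>\<close> have consecutive Chebyshev values \<open>sin (k \<theta>) / sin \<theta>\<close> as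
  coordinates, where \<open>cos\<^sup>2 \<theta>\<close> is the product in question. If that product is below \<open>1\<close>, then the
  coordinates turn negative once \<open>k \<theta>\<close> passes \<open>\<pi>\<close>, so there must be a braid relation, and it forces
  \<open>k \<theta> = \<pi>\<close>. If the product is at least \<open>1\<close>, then the coordinates stay positive and there is none.

  The positivity needs the standard facts on lengths and root signs. As the pairing is not
  symmetric and the simple roots may be linearly dependent, these rest on the positive cone of the
  simple roots, which is pointed and has each simple root as an extremal ray.
\<close>

section \<open>Positive linear combinations\<close>

lemma PLC_mono: "A \<subseteq> C \<Longrightarrow> PLC A \<subseteq> PLC C"
  unfolding PLC_def by blast

lemma PLC_superset: "a \<in> A \<Longrightarrow> a \<in> PLC A"
  unfolding PLC_def by (rule CollectI, rule exI[of _ "{a}"], rule exI[of _ "\<lambda>_. 1"]) auto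

lemma PLC_scaleR:
  assumes "x \<in> PLC A" "0 < k"
  shows "k *\<^sub>R x \<in> PLC A"
proof -
  from assms(1) obtain F c where F: "finite F" "F \<subseteq> A" "\<forall>a\<in>F. 0 \<le> c a" "\<exists>a\<in>F. 0 < c a"
    "x = (\<Sum>a\<in>F. c a *\<^sub>R a)"
    unfolding PLC_def by blast
  have "\<exists>a\<in>F. 0 < k * c a"
    using F(4) assms(2) by (auto simp: zero_less_mult_iff)
  then show ?thesis
    unfolding PLC_def using F assms(2)
    by (intro CollectI exI[of _ F] exI[of _ "\<lambda>a. k * c a"]) (auto simp: scaleR_sum_right)
qed

lemma PLC_add:
  assumes "x \<in> PLC A" "y \<in> PLC A"
  shows "x + y \<in> PLC A"
proof -
  from assms(1) obtain F c where F: "finite F" "F \<subseteq> A" "\<forall>a\<in>F. 0 \<le> c a" "\<exists>a\<in>F. 0 < c a"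
    "x = (\<Sum>a\<in>F. c a *\<^sub>R a)"
    unfolding PLC_def by blast
  from assms(2) obtain G d where G: "finite G" "G \<subseteq> A" "\<forall>a\<in>G. 0 \<le> d a" "\<exists>a\<in>G. 0 < d a"
    "y = (\<Sum>a\<in>G. d a *\<^sub>R a)"
    unfolding PLC_def by blast
  define e where "e a = (if a \<in> F then c a else 0) + (if a \<in> G then d a else 0)" for a
  have "x = (\<Sum>a\<in>F \<union> G. (if a \<in> F then c a else 0) *\<^sub>R a)"
    unfolding F(5) by (rule sum.mono_neutral_cong_left) (use F(1) G(1) in auto)
  moreover have "y = (\<Sum>a\<in>F \<union> G. (if a \<in> G then d a else 0) *\<^sub>R a)"
    unfolding G(5) by (rule sum.mono_neutral_cong_left) (use F(1) G(1) in auto)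
  ultimately have "x + y = (\<Sum>a\<in>F \<union> G. e a *\<^sub>R a)"
    by (simp add: e_def scaleR_add_left sum.distrib)
  moreover have "\<forall>a\<in>F \<union> G. 0 \<le> e a"
    using F(3) G(3) by (auto simp: e_def)
  moreover have "\<exists>a\<in>F \<union> G. 0 < e a"
    using F(4) G(3) by (fastforce simp: e_def intro: add_pos_nonneg)
  ultimately show ?thesis
    unfolding PLC_def using F(1,2) G(1,2) by (intro CollectI exI[of _ "F \<union> G"] exI[of _ e]) auto
qed

lemma PLC_combination:
  assumes "x \<in> PLC A" "y \<in> PLC A" "0 \<le> p" "0 \<le> q" "0 < p \<or> 0 < q"
  shows "p *\<^sub>R x + q *\<^sub>R y \<in> PLC A"
proof (cases "p = 0 \<or> q = 0")
  case True
  then show ?thesis using assms by (auto intro: PLC_scaleR)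
next
  case False
  then show ?thesis using assms by (auto intro!: PLC_add PLC_scaleR)
qed

text \<open>Separates the coefficient of \<open>a\<close>. The remainder can be the trivial
  combination, which \<open>PLC\<close> excludes, hence the added \<open>0\<close>.\<close>

lemma PLC_split:
  assumes "z \<in> PLC A"
  obtains p z0 where "0 \<le> p" "z = p *\<^sub>R a + z0" "z0 \<in> insert 0 (PLC (A - {a}))"
proof -
  from assms(1) obtain F c where F: "finite F" "F \<subseteq> A" "\<forall>a\<in>F. 0 \<le> c a" "\<exists>a\<in>F. 0 < c a"
    "z = (\<Sum>a\<in>F. c a *\<^sub>R a)"
    unfolding PLC_def by blast
  define z0 where "z0 = (\<Sum>b\<in>F - {a}. c b *\<^sub>R b)"
  define p where "p = (if a \<in> F then c a else 0)"
  have "z = p *\<^sub>R a + z0"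
    unfolding F(5) z0_def p_def using F(1) by (simp add: sum.remove)
  moreover have "0 \<le> p"
    using F(3) by (simp add: p_def)
  moreover have "z0 \<in> insert 0 (PLC (A - {a}))"
  proof (cases "\<exists>b\<in>F - {a}. 0 < c b")
    case True
    then show ?thesis
      unfolding PLC_def z0_def using F
      by (intro insertI2 CollectI exI[of _ "F - {a}"] exI[of _ c]) auto
  next
    case False
    then have "\<forall>b\<in>F - {a}. c b = 0" using F(3) by force
    then show ?thesis by (simp add: z0_def)
  qed
  ultimately show thesis using that by blast
qed

text \<open>The parts of \<open>z\<close> and \<open>z'\<close> away from \<open>a\<close> add up to
  a multiple \<open>k\<close> of \<open>a\<close>. If \<open>z0\<close> were nonzero, then
  \<open>k > 0\<close> would put \<open>a\<close> into the cone of the other generators, and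
  otherwise \<open>0\<close> would lie in \<open>PLC A\<close>.\<close>

lemma PLC_extremal:
  assumes "0 \<notin> PLC A" "a \<in> A" "a \<notin> PLC (A - {a})"
    and "z \<in> PLC A" "z' \<in> PLC A" "z + z' = q *\<^sub>R a"
  shows "\<exists>l>0. z = l *\<^sub>R a"
proof -
  obtain p z0 where z: "0 \<le> p" "z = p *\<^sub>R a + z0" "z0 \<in> insert 0 (PLC (A - {a}))"
    using PLC_split[OF assms(4)] .
  obtain p' z0' where z': "0 \<le> p'" "z' = p' *\<^sub>R a + z0'" "z0' \<in> insert 0 (PLC (A - {a}))"
    using PLC_split[OF assms(5)] .
  have "z0 = 0"
  proof (rule ccontr)
    assume "z0 \<noteq> 0"
    then have sum: "z0 + z0' \<in> PLC (A - {a})"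
      using z(3) z'(3) PLC_add by auto
    define k where "k = q - p - p'"
    have k: "z0 + z0' = k *\<^sub>R a"
      using assms(6) unfolding z(2) z'(2) k_def by (simp add: algebra_simps)
    show False
    proof (cases "0 < k")
      case True
      then have "a = (1 / k) *\<^sub>R (z0 + z0')" using k by simp
      then show False
        using PLC_scaleR[OF sum, of "1 / k"] True assms(3) by simp
    next
      case False
      have "z0 + z0' \<in> PLC A" using sum PLC_mono[of "A - {a}" A] by auto
      then have "1 *\<^sub>R (z0 + z0') + (- k) *\<^sub>R a \<in> PLC A"
        using False PLC_superset[OF assms(2)] by (intro PLC_combination) auto
      then show False using k assms(1) by simp
    qed
  qed
  moreover from this have "p \<noteq> 0" using z(2) assms(1,4) by auto
  ultimately show ?thesis using z by (intro exI[of _ p]) auto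
qed

section \<open>Chebyshev polynomials of the second kind\<close>

text \<open>The usual indexing is shifted by one, so that \<open>cheb (cos \<theta>) k = sin (k \<theta>) / sin \<theta>\<close>.\<close>

fun cheb :: "real \<Rightarrow> nat \<Rightarrow> real" where
  "cheb c 0 = 0"
| "cheb c (Suc 0) = 1"
| "cheb c (Suc (Suc k)) = 2 * c * cheb c (Suc k) - cheb c k"

lemma cheb_cos: "cheb (cos \<theta>) k * sin \<theta> = sin (real k * \<theta>)"
proof (induction "cos \<theta>" k rule: cheb.induct)
  case (3 k)
  have *: "real (Suc (Suc k)) * \<theta> = real (Suc k) * \<theta> + \<theta>" "real k * \<theta> = real (Suc k) * \<theta> - \<theta>"
    by (simp_all add: algebra_simps)
  have "cheb (cos \<theta>) (Suc (Suc k)) * sin \<theta> = 2 * cos \<theta> * sin (real (Suc k) * \<theta>) - sin (real k * \<theta>)"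
    using 3 by (simp add: algebra_simps)
  also have "\<dots> = sin (real (Suc (Suc k)) * \<theta>)"
    unfolding * by (simp only: sin_add sin_diff) (simp add: algebra_simps)
  finally show ?case .
qed auto

lemma cheb_cos_pos:
  assumes "0 < \<theta>" "\<theta> < pi" "0 < k" "real k * \<theta> < pi"
  shows "0 < cheb (cos \<theta>) k"
proof -
  have "0 < sin \<theta>" "0 < sin (real k * \<theta>)"
    using assms by (auto intro!: sin_gt_zero)
  then show ?thesis using cheb_cos[of \<theta> k] by (metis zero_less_mult_pos2)
qed

lemma cheb_pos:
  assumes "1 \<le> c" "0 < k"
  shows "0 < cheb c k"
proof -
  \<comment> \<open>Monotonicity is carried along because the recursion subtracts
    \<open>cheb c k\<close>.\<close>
  have "0 \<le> cheb c k \<and> cheb c k < cheb c (Suc k)" for k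
  proof (induction k)
    case (Suc k)
    have "2 * cheb c (Suc k) \<le> 2 * c * cheb c (Suc k)"
      using Suc assms(1) by (intro mult_right_mono) auto
    moreover have "cheb c (Suc (Suc k)) = 2 * c * cheb c (Suc k) - cheb c k" by simp
    ultimately show ?case using Suc by linarith
  qed auto
  from this[of "k - 1"] show ?thesis using assms(2) by simp
qed

section \<open>Alternating products\<close>

context group
begin

text \<open>The product \<open>\<dots> x y x y\<close> of \<open>k\<close> alternating factors, the last of which is \<open>y\<close>.\<close>

fun alt :: "'a \<Rightarrow> 'a \<Rightarrow> nat \<Rightarrow> 'a" where
  "alt x y 0 = \<one>"
| "alt x y (Suc k) = (if even k then y else x) \<otimes> alt x y k"

lemma alt_closed [simp]:
  assumes "x \<in> carrier G" "y \<in> carrier G"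
  shows "alt x y k \<in> carrier G"
  using assms by (induction k) auto

lemma alt_snoc:
  assumes "x \<in> carrier G" "y \<in> carrier G"
  shows "alt x y k \<otimes> x = alt y x (Suc k)"
  using assms by (induction k) (auto simp: m_assoc)

lemma alt_even:
  assumes "x \<in> carrier G" "y \<in> carrier G"
  shows "alt x y (2 * k) = (x \<otimes> y) [^] k"
proof (induction k)
  case (Suc k)
  then show ?case using assms nat_pow_mult[of "x \<otimes> y" 1 k] by (auto simp: m_assoc)
qed auto

lemma inv_mult_cancel:
  assumes "g \<in> carrier G" "h \<in> carrier G"
  shows "g \<otimes> (inv g \<otimes> h) = h" "inv g \<otimes> (g \<otimes> h) = h"
  using assms by (simp_all flip: m_assoc)

lemma involution_cancel:
  assumes "x \<in> carrier G" "g \<in> carrier G" "x \<otimes> x = \<one>"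
  shows "x \<otimes> (x \<otimes> g) = g"
  using assms by (simp flip: m_assoc)

text \<open>Leading involutions move one at a time from the right side to the left, until the right
  side is empty and the left side is \<open>alt x y (2 * m)\<close>.\<close>

lemma alt_braid_iff:
  assumes "x \<in> carrier G" "y \<in> carrier G" "x \<otimes> x = \<one>" "y \<otimes> y = \<one>"
  shows "alt x y m = alt y x m \<longleftrightarrow> (x \<otimes> y) [^] m = \<one>"
proof -
  \<comment> \<open>The parity condition says that \<open>alt x y (Suc i)\<close> and
    \<open>alt y x (Suc j)\<close> have the same leading factor.\<close>
  have step: "alt x y (Suc i) = alt y x j \<longleftrightarrow> alt x y i = alt y x (Suc j)"
    if "even i \<longleftrightarrow> odd j" for i j
  proof -
    define L where "L = (if even i then y else x)"
    have L: "L \<in> carrier G" "L \<otimes> L = \<one>" using assms by (auto simp: L_def)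
    have "alt x y (Suc i) = L \<otimes> alt x y i" "alt y x (Suc j) = L \<otimes> alt y x j"
      using that by (auto simp: L_def)
    then show ?thesis
      using involution_cancel[OF L(1) _ L(2)] assms alt_closed by metis
  qed
  have "alt x y (m + j) = alt y x (m - j) \<longleftrightarrow> alt x y m = alt y x m" if "j \<le> m" for j
    using that
  proof (induction j)
    case (Suc j)
    have "alt x y (Suc (m + j)) = alt y x (m - Suc j) \<longleftrightarrow> alt x y (m + j) = alt y x (Suc (m - Suc j))"
      using Suc.prems by (intro step) auto
    then show ?case using Suc by (simp add: Suc_diff_Suc)
  qed auto
  from this[of m] show ?thesis
    using alt_even[OF assms(1,2), of m] by (simp add: mult_2)
qed

text \<open>Moving the inverse to the other side turns the conjugation into a braid relation of
  length \<open>Suc k\<close>.\<close>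

lemma alt_conjugate_eq_iff:
  assumes "x \<in> carrier G" "y \<in> carrier G" "x \<otimes> x = \<one>" "y \<otimes> y = \<one>"
  shows "alt x y k \<otimes> x \<otimes> inv (alt x y k) = (if even k then y else x)
         \<longleftrightarrow> (x \<otimes> y) [^] Suc k = \<one>"
proof -
  let ?g = "alt x y k" and ?L = "if even k then y else x"
  have "?L \<in> carrier G" using assms by auto
  then have "?g \<otimes> x \<otimes> inv ?g = ?L \<longleftrightarrow> ?g \<otimes> x = ?L \<otimes> ?g"
    using assms(1,2) by (intro inv_solve_right') simp_all
  also have "\<dots> \<longleftrightarrow> alt x y (Suc k) = alt y x (Suc k)"
    using alt_snoc[OF assms(1,2)] by (auto simp del: alt.simps simp: alt.simps(2)[of x y])
  finally show ?thesis by (simp only: alt_braid_iff[OF assms])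
qed

end

section \<open>The Coxeter matrix of a datum\<close>

lemma cos_pi_div_nonneg:
  assumes "2 \<le> m"
  shows "0 \<le> cos (pi / real m)"
proof -
  have "0 \<le> pi / real m" "pi / real m \<le> pi / 2"
    using assms by (auto simp: field_simps)
  then show ?thesis using pi_gt_zero by (intro cos_ge_zero) linarith+
qed

text \<open>The angles lie in the range where the cosine is nonnegative and injective. This makes
  the \<open>THE\<close> in \<open>datum_matrix\<close> well defined.\<close>

lemma cos_squared_pi_div_inj:
  assumes "2 \<le> m" "2 \<le> n" "(cos (pi / real m))\<^sup>2 = (cos (pi / real n))\<^sup>2"
  shows "m = n"
proof -
  have "cos (pi / real m) = cos (pi / real n)"
    using assms cos_pi_div_nonneg by (simp add: power2_eq_iff_nonneg)
  moreover have "0 \<le> pi / real k" "pi / real k \<le> pi" if "2 \<le> k" for k :: nat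
    using that pi_gt_zero by (simp_all add: pos_divide_le_eq)
  ultimately have "pi / real m = pi / real n"
    using assms(1,2) cos_inj_pi by metis
  then show ?thesis using assms(1,2) by simp
qed

lemma datum_matrix_eq_enat:
  assumes "s \<noteq> t" "datum_matrix \<alpha> \<beta> B s t = enat m"
  shows "2 \<le> m" "B (\<alpha> s) (\<beta> t) * B (\<alpha> t) (\<beta> s) = (cos (pi / real m))\<^sup>2"
proof -
  let ?P = "\<lambda>m::nat. 2 \<le> m \<and> B (\<alpha> s) (\<beta> t) * B (\<alpha> t) (\<beta> s) = (cos (pi / real m))\<^sup>2"
  have ex: "\<exists>m. ?P m"
    using assms by (auto simp: datum_matrix_def split: if_splits)
  then have m: "m = (THE m. ?P m)"
    using assms by (simp add: datum_matrix_def)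
  from ex obtain k where k: "?P k" by blast
  have "?P m"
    unfolding m by (rule theI[of ?P, OF k]) (metis k cos_squared_pi_div_inj)
  then show "2 \<le> m" "B (\<alpha> s) (\<beta> t) * B (\<alpha> t) (\<beta> s) = (cos (pi / real m))\<^sup>2"
    by auto
qed

text \<open>Here \<open>a\<close> and \<open>b\<close> are the negated pairings of two roots.
  Rescaling one root by \<mu> = \<open>sqrt (a / b)\<close> replaces both by their geometric mean
  \<open>c\<close>.\<close>

lemma symmetrizing_scale:
  fixes a b :: real
  assumes "0 \<le> a" "0 \<le> b" "a = 0 \<longleftrightarrow> b = 0"
  obtains c \<mu> where "0 \<le> c" "0 < \<mu>" "a = c * \<mu>" "b * \<mu> = c" "c\<^sup>2 = a * b"
proof (cases "a = 0")
  case True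
  then show thesis using assms that[of 0 1] by simp
next
  case False
  then have "0 < a" "0 < b" using assms by auto
  then have "a = sqrt (a * b) * sqrt (a / b)" "b * sqrt (a / b) = sqrt (a * b)"
    by (auto simp: real_sqrt_divide real_sqrt_mult field_simps)
  with \<open>0 < a\<close> \<open>0 < b\<close> show thesis
    by (intro that[of "sqrt (a * b)" "sqrt (a / b)"]) auto
qed

section \<open>Lengths, actions and roots\<close>

text \<open>Adds no assumption, but makes \<open>W\<close> a structure, so that group operations
  without index refer to it.\<close>

locale realization =
  coxeter_realization S \<alpha> \<beta> B W r act1 act2 \<phi>
  for S :: "'s set"
    and \<alpha> :: "'s \<Rightarrow> 'v1::real_vector"
    and \<beta> :: "'s \<Rightarrow> 'v2::real_vector"
    and B :: "'v1 \<Rightarrow> 'v2 \<Rightarrow> real"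
    and W :: "('w, 'm) monoid_scheme" (structure)
    and r :: "'s \<Rightarrow> 'w"
    and act1 :: "'w \<Rightarrow> 'v1 \<Rightarrow> 'v1"
    and act2 :: "'w \<Rightarrow> 'v2 \<Rightarrow> 'v2"
    and \<phi> :: "'v1 \<Rightarrow> 'v2"
begin

abbreviation "wv \<equiv> word_value W r"
abbreviation "len \<equiv> cox_length W S r"
abbreviation "Pos \<equiv> PLC (\<alpha> ` S)"
abbreviation "\<Phi> \<equiv> roots W S act1 \<alpha>"
abbreviation "rfl \<equiv> root_reflection W S r act1 \<alpha>"

lemma r_in [simp, intro]: "s \<in> S \<Longrightarrow> r s \<in> carrier W"
  using r_closed by auto

lemma wv_simps [simp]: "wv [] = \<one>" "wv (s # u) = r s \<otimes> wv u"
  by (simp_all add: word_value_def)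

lemma wv_closed [simp, intro]: "u \<in> lists S \<Longrightarrow> wv u \<in> carrier W"
  by (induction u) auto

lemma wv_append: "u \<in> lists S \<Longrightarrow> v \<in> lists S \<Longrightarrow> wv (u @ v) = wv u \<otimes> wv v"
  by (induction u) (auto simp: m_assoc)

lemma wv_snoc: "u \<in> lists S \<Longrightarrow> s \<in> S \<Longrightarrow> wv (u @ [s]) = wv u \<otimes> r s"
  by (simp add: wv_append)

lemma braid_relation:
  assumes "s \<in> S" "t \<in> S" "datum_matrix \<alpha> \<beta> B s t = enat m"
  shows "(r s \<otimes> r t) [^] m = \<one>"
proof -
  have pow: "concat (replicate k [s, t]) \<in> lists S \<and>
      wv (concat (replicate k [s, t])) = (r s \<otimes> r t) [^] k" for k
  proof (induction k)
    case (Suc k)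
    have "(r s \<otimes> r t) [^] Suc k = r s \<otimes> (r t \<otimes> (r s \<otimes> r t) [^] k)"
      using assms(1,2) nat_pow_Suc2[of "r s \<otimes> r t" k] by (metis m_assoc m_closed nat_pow_closed r_in)
    then show ?case using Suc assms(1,2) by simp
  qed auto
  have "coxeter_congruence S (datum_matrix \<alpha> \<beta> B) ([] @ concat (replicate m [s, t]) @ []) ([] @ [])"
    using assms by (intro coxeter_congruence.relation) auto
  then have "wv (concat (replicate m [s, t])) = wv []"
    using presentation[of "concat (replicate m [s, t])" "[]"] pow by simp
  then show ?thesis using pow by simp
qed

lemma r_square [simp]: "s \<in> S \<Longrightarrow> r s \<otimes> r s = \<one>"
  using braid_relation[of s s 1] by (simp add: datum_matrix_def one_enat_def)

lemma inv_r [simp]: "s \<in> S \<Longrightarrow> inv (r s) = r s"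
  by (simp add: inv_equality)

lemma mult_r_r [simp]: "s \<in> S \<Longrightarrow> g \<in> carrier W \<Longrightarrow> g \<otimes> r s \<otimes> r s = g"
  by (simp add: m_assoc)

lemma r_r_mult [simp]: "s \<in> S \<Longrightarrow> g \<in> carrier W \<Longrightarrow> r s \<otimes> (r s \<otimes> g) = g"
  by (simp flip: m_assoc)

lemma ex_word:
  assumes "g \<in> carrier W"
  obtains u where "u \<in> lists S" "wv u = g"
proof -
  have "\<exists>u\<in>lists S. wv u = g" if "g \<in> generate W (r ` S)"
    using that
  proof induction
    case one
    show ?case by (rule bexI[of _ "[]"]) auto
  next
    case (incl h)
    then obtain s where "s \<in> S" "h = r s" by blast
    then show ?case by (intro bexI[of _ "[s]"]) auto
  next
    case (inv h)
    then obtain s where "s \<in> S" "h = r s" by blast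
    then show ?case by (intro bexI[of _ "[s]"]) auto
  next
    case (eng h1 h2)
    then obtain u v where "u \<in> lists S" "v \<in> lists S" "wv u = h1" "wv v = h2" by blast
    then show ?case by (intro bexI[of _ "u @ v"]) (auto simp: wv_append)
  qed
  then show thesis using that assms r_generate by blast
qed

lemma carrier_induct [consumes 1, case_names one step]:
  assumes "g \<in> carrier W" "P \<one>"
    and "\<And>s g. s \<in> S \<Longrightarrow> g \<in> carrier W \<Longrightarrow> P g \<Longrightarrow> P (r s \<otimes> g)"
  shows "P g"
proof -
  obtain u where u: "u \<in> lists S" "wv u = g" using ex_word[OF assms(1)] .
  from u(1) have "P (wv u)"
    by (induction u) (use assms(2,3) in auto)
  then show ?thesis using u(2) by simp
qed

section \<open>Lengths under right multiplication by generators\<close>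

lemma ex_reduced_word:
  assumes "g \<in> carrier W"
  obtains u where "u \<in> lists S" "length u = len g" "wv u = g"
proof -
  obtain u where "u \<in> lists S" "wv u = g" using ex_word[OF assms] .
  then have "\<exists>n. \<exists>u\<in>lists S. length u = n \<and> wv u = g" by blast
  then have "\<exists>u\<in>lists S. length u = len g \<and> wv u = g"
    unfolding cox_length_def by (rule LeastI_ex)
  then show thesis using that by blast
qed

lemma len_le: "u \<in> lists S \<Longrightarrow> len (wv u) \<le> length u"
  unfolding cox_length_def by (rule Least_le) auto

lemma len_mult_r_le:
  assumes "g \<in> carrier W" "s \<in> S"
  shows "len (g \<otimes> r s) \<le> Suc (len g)"
proof -
  obtain u where "u \<in> lists S" "length u = len g" "wv u = g" using ex_reduced_word[OF assms(1)] .
  then show ?thesis using len_le[of "u @ [s]"] assms(2) by (simp add: wv_snoc)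
qed

text \<open>All relators have even length. Hence multiplication by a generator cannot preserve the
  length.\<close>

lemma even_length_cong:
  assumes "coxeter_congruence S M u v"
  shows "even (length u) \<longleftrightarrow> even (length v)"
  using assms
proof induction
  case (relation s t k u v)
  have "even (length (concat (replicate k [s, t])))" by (induction k) auto
  then show ?case by simp
qed auto

lemma len_mult_r_neq:
  assumes "g \<in> carrier W" "s \<in> S"
  shows "len (g \<otimes> r s) \<noteq> len g"
proof
  assume eq: "len (g \<otimes> r s) = len g"
  obtain u where u: "u \<in> lists S" "length u = len g" "wv u = g"
    using ex_reduced_word[OF assms(1)] .
  obtain v where v: "v \<in> lists S" "length v = len (g \<otimes> r s)" "wv v = g \<otimes> r s"
    using ex_reduced_word[of "g \<otimes> r s"] assms by auto
  have "wv (u @ [s]) = wv v" using u v assms by (simp add: wv_snoc)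
  then have "even (length (u @ [s])) \<longleftrightarrow> even (length v)"
    using presentation[of "u @ [s]" v] u v assms by (intro even_length_cong) auto
  then show False using u v eq by simp
qed

lemma len_mult_r_less:
  assumes "g \<in> carrier W" "s \<in> S" "\<not> len g < len (g \<otimes> r s)"
  shows "Suc (len (g \<otimes> r s)) = len g"
  using len_mult_r_le[of "g \<otimes> r s" s] len_mult_r_neq[of g s] assms by simp

text \<open>The induction peels off the rightmost factor, to which the bound for right
  multiplication applies; this exchanges \<open>s\<close> and \<open>t\<close>.\<close>

lemma len_mult_alt_le:
  assumes "g \<in> carrier W" "s \<in> S" "t \<in> S"
  shows "len (g \<otimes> alt (r s) (r t) k) \<le> len g + k"
  using assms
proof (induction k arbitrary: s t)
  case (Suc k)
  have "g \<otimes> alt (r s) (r t) (Suc k) = g \<otimes> alt (r t) (r s) k \<otimes> r t"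
    using Suc.prems by (simp add: m_assoc alt_snoc del: alt.simps)
  then show ?case
    using len_mult_r_le[of "g \<otimes> alt (r t) (r s) k" t] Suc.IH[of t s] Suc.prems by simp
qed auto

section \<open>Linearity of the action and invariance of the pairing\<close>

lemma act1_one [simp]: "act1 \<one> v = v"
  using V1.id_eq_one by (metis UNIV_I restrict_apply')

lemma act2_one [simp]: "act2 \<one> v = v"
  using V2.id_eq_one by (metis UNIV_I restrict_apply')

lemma act1_mult: "g \<in> carrier W \<Longrightarrow> h \<in> carrier W \<Longrightarrow> act1 (g \<otimes> h) v = act1 g (act1 h v)"
  by (rule V1.composition_rule) auto

lemma act2_mult: "g \<in> carrier W \<Longrightarrow> h \<in> carrier W \<Longrightarrow> act2 (g \<otimes> h) v = act2 g (act2 h v)"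
  by (rule V2.composition_rule) auto

lemma act1_inv_act1 [simp]: "g \<in> carrier W \<Longrightarrow> act1 (inv g) (act1 g v) = v"
  by (simp flip: act1_mult)

lemma act1_act1_inv [simp]: "g \<in> carrier W \<Longrightarrow> act1 g (act1 (inv g) v) = v"
  by (simp flip: act1_mult)

lemmas B_left = linear_add[OF linear_left] linear_diff[OF linear_left] linear_neg[OF linear_left]
  linear_scale[OF linear_left]
lemmas B_right = linear_add[OF linear_right] linear_diff[OF linear_right]
  linear_neg[OF linear_right] linear_scale[OF linear_right]

lemma linear_act1: "g \<in> carrier W \<Longrightarrow> linear (act1 g)"
proof (induction rule: carrier_induct)
  case one
  show ?case by (rule linearI) auto
next
  case (step s g)
  show ?case
    by (rule linearI)
      (use step in \<open>simp_all add: act1_mult act1_simple linear_add linear_scale B_left algebra_simps\<close>)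
qed

lemmas act1_linear = linear_add[OF linear_act1] linear_diff[OF linear_act1]
  linear_neg[OF linear_act1] linear_scale[OF linear_act1]

lemma B_invariant: "g \<in> carrier W \<Longrightarrow> B (act1 g v) (act2 g y) = B v y"
proof (induction rule: carrier_induct)
  case (step s g)
  then show ?case
    by (simp add: act1_mult act2_mult act1_simple act2_simple B_left B_right pairing_self algebra_simps)
qed auto

lemma act1_conjugate:
  assumes "w \<in> carrier W" "s \<in> S"
  shows "act1 (w \<otimes> r s \<otimes> inv w) v = v - (2 * B v (act2 w (\<beta> s))) *\<^sub>R act1 w (\<alpha> s)"
  using assms B_invariant[OF assms(1), of "act1 (inv w) v" "\<beta> s"]
  by (simp add: act1_mult act1_simple act1_linear)

text \<open>Each new factor keeps one coefficient \<open>p\<close> and replaces the other,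
  \<open>q\<close>, by \<open>2 * c * p - q\<close>, which is the recursion of
  \<open>cheb\<close>.\<close>

lemma act1_alt:
  assumes "g \<in> carrier W" "h \<in> carrier W"
    and "act1 g e = - e" "act1 h e = e + (2 * c) *\<^sub>R f"
    and "act1 h f = - f" "act1 g f = f + (2 * c) *\<^sub>R e"
  shows "act1 (alt g h k) e =
    cheb c (Suc k) *\<^sub>R (if even k then e else f) + cheb c k *\<^sub>R (if even k then f else e)"
proof (induction k)
  case (Suc k)
  have "(c * (2 * cheb c (Suc k))) *\<^sub>R v = cheb c k *\<^sub>R v + cheb c (Suc (Suc k)) *\<^sub>R v" for v :: 'v1
    by (simp flip: scaleR_add_left)
  with Suc show ?case
    using assms by (cases "even k") (simp_all add: act1_mult act1_linear algebra_simps del: cheb.simps)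
qed auto

lemma zero_notin_Pos: "0 \<notin> Pos"
  using zero_notin_PLC_alpha .

lemma alpha_Pos [simp]: "s \<in> S \<Longrightarrow> \<alpha> s \<in> Pos"
  by (rule PLC_superset) auto

end

section \<open>Positive and negative roots\<close>

context realization
begin

lemma act1_r_alpha: "s \<in> S \<Longrightarrow> act1 (r s) (\<alpha> s) = - \<alpha> s"
  by (simp add: act1_simple pairing_self scaleR_2)

text \<open>For a finite entry \<open>m\<close>, \<open>c\<close> is the cosine of
  \<open>pi / m\<close>, and \<open>k < m\<close> keeps \<open>k * pi / m\<close> below
  \<open>pi\<close>; the next multiple may equal \<open>pi\<close>, so the second inequality is not
  strict. For an infinite entry, \<open>1 \<le> c\<close>.\<close>

lemma simple_pair_cheb:
  assumes "s \<in> S" "t \<in> S" "s \<noteq> t"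
  obtains c \<mu> where "0 \<le> c" "0 < \<mu>" "- B (\<alpha> s) (\<beta> t) = c * \<mu>" "- B (\<alpha> t) (\<beta> s) * \<mu> = c"
    and "\<forall>k>0. (\<forall>m. datum_matrix \<alpha> \<beta> B s t = enat m \<longrightarrow> k < m)
           \<longrightarrow> 0 < cheb c k \<and> 0 \<le> cheb c (Suc k)"
proof -
  let ?a = "- B (\<alpha> s) (\<beta> t)" and ?b = "- B (\<alpha> t) (\<beta> s)"
  obtain c \<mu> where c: "0 \<le> c" "0 < \<mu>" "?a = c * \<mu>" "?b * \<mu> = c" "c\<^sup>2 = ?a * ?b"
    using symmetrizing_scale[of ?a ?b] pairing_nonpos[of s t] pairing_nonpos[of t s]
      pairing_zero_iff[OF assms] assms by auto
  have "0 < cheb c k \<and> 0 \<le> cheb c (Suc k)"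
    if k: "0 < k" "\<forall>m. datum_matrix \<alpha> \<beta> B s t = enat m \<longrightarrow> k < m" for k
  proof (cases "datum_matrix \<alpha> \<beta> B s t")
    case (enat m)
    note m = datum_matrix_eq_enat[OF assms(3) enat]
    define \<theta> where "\<theta> = pi / real m"
    have "c\<^sup>2 = (cos \<theta>)\<^sup>2" using c(5) m(2) by (simp add: \<theta>_def)
    then have c_cos: "c = cos \<theta>"
      using c(1) cos_pi_div_nonneg[OF m(1)] by (simp add: power2_eq_iff_nonneg \<theta>_def)
    have \<theta>: "0 < \<theta>" "\<theta> < pi" "real m * \<theta> = pi" using m(1) by (auto simp: \<theta>_def field_simps)
    have "real k * \<theta> < pi" using k(2) enat \<theta> by (metis mult_less_cancel_right_pos of_nat_less_iff)
    then have "0 < cheb c k" using \<theta> k(1) c_cos cheb_cos_pos by simp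
    moreover have "0 \<le> cheb c (Suc k)"
    proof -
      have "real (Suc k) * \<theta> \<le> real m * \<theta>"
        using k(2) enat \<theta> by (intro mult_right_mono) auto
      then have "0 \<le> sin (real (Suc k) * \<theta>)" using \<theta> by (intro sin_ge_zero) auto
      moreover have "0 < sin \<theta>" using \<theta> by (intro sin_gt_zero) auto
      ultimately show ?thesis
        using cheb_cos[of \<theta> "Suc k"] c_cos by (metis zero_le_mult_iff not_le)
    qed
    ultimately show ?thesis by simp
  next
    case infinity
    then have "1 \<le> c\<^sup>2"
      using pairing_product[OF assms] assms(3) c(5) by (auto simp: datum_matrix_def split: if_splits)
    then have "1 \<le> c" using c(1) power2_le_imp_le[of 1 c] by simp
    then show ?thesis using cheb_pos[of c k] cheb_pos[of c "Suc k"] k(1) by simp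
  qed
  with c(1-4) show thesis using that by blast
qed

text \<open>Split off the longest alternating tail in \<open>r s, r t\<close> from a reduced expression of \<open>w\<close>, where
  \<open>r t\<close> is a right descent of \<open>w\<close>. The remaining factor \<open>v\<close> has neither of the two as a right descent,
  so that induction applies to it, and the tail, being shorter than the order of \<open>r s \<cdot> r t\<close>, maps
  \<open>\<alpha> s\<close> to a nonnegative combination of \<open>\<alpha> s\<close> and \<open>\<alpha> t\<close>.\<close>

lemma ascent_imp_positive:
  assumes "w \<in> carrier W" "s \<in> S" "len w < len (w \<otimes> r s)"
  shows "act1 w (\<alpha> s) \<in> Pos"
  using assms
proof (induction "len w" arbitrary: w s rule: less_induct)
  case less
  obtain u where u: "u \<in> lists S" "length u = len w" "wv u = w"
    using ex_reduced_word[OF less.prems(1)] .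
  show ?case
  proof (cases u rule: rev_cases)
    case Nil
    then show ?thesis using u(3)[symmetric] less.prems(2) by simp
  next
    case (snoc u' t)
    have t: "t \<in> S" "u' \<in> lists S" using u(1) snoc by auto
    have wt: "w \<otimes> r t = wv u'"
      using wv_snoc[OF t(2,1)] mult_r_r[OF t(1) wv_closed[OF t(2)]] u(3) snoc by simp
    then have len_wt: "len (w \<otimes> r t) < len w"
      using len_le[OF t(2)] u(2) snoc by simp
    then have "s \<noteq> t" using less.prems(3) by auto
    \<comment> \<open>An alternating tail of length \<open>k\<close> splits off with lengths adding
      up.\<close>
    define P where "P k \<longleftrightarrow>
      (\<exists>v\<in>carrier W. w = v \<otimes> alt (r s) (r t) k \<and> len v + k = len w)" for k
    have "P 0" using less.prems(1) by (auto simp: P_def)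
    have "Suc (len (w \<otimes> r t)) = len w"
      using len_mult_r_less[OF less.prems(1) t(1)] len_wt by simp
    then have "P 1"
      using less.prems(1) t unfolding P_def by (intro bexI[of _ "w \<otimes> r t"]) auto
    \<comment> \<open>By the braid relation, a tail of length \<open>m\<close> could be rewritten to
      end in \<open>r s\<close>, making \<open>r s\<close> a right descent of
      \<open>w\<close>.\<close>
    have not_P: "\<not> P m" if m: "datum_matrix \<alpha> \<beta> B s t = enat m" for m
    proof
      assume "P m"
      then obtain v where v: "v \<in> carrier W" "w = v \<otimes> alt (r s) (r t) m" "len v + m = len w"
        unfolding P_def by blast
      obtain j where j: "m = Suc j"
        using datum_matrix_eq_enat(1)[OF \<open>s \<noteq> t\<close> m] by (cases m) auto
      have "alt (r s) (r t) m = alt (r t) (r s) m"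
        using braid_relation[OF less.prems(2) t(1) m] less.prems(2) t(1) by (simp add: alt_braid_iff)
      then have "w = v \<otimes> alt (r s) (r t) j \<otimes> r s"
        using v j less.prems(2) t(1) by (simp add: m_assoc alt_snoc del: alt.simps)
      then have "w \<otimes> r s = v \<otimes> alt (r s) (r t) j"
        using v(1) less.prems(2) t(1) by simp
      then show False
        using len_mult_alt_le[OF v(1) less.prems(2) t(1), of j] v(3) j less.prems(3) by simp
    qed
    have "\<exists>k. \<not> P k"
      by (rule exI[of _ "Suc (len w)"]) (auto simp: P_def)
    define K where "K = (LEAST k. \<not> P k)"
    have K: "\<not> P K" "\<And>k. k < K \<Longrightarrow> P k"
      unfolding K_def using LeastI_ex[OF \<open>\<exists>k. \<not> P k\<close>] not_less_Least by blast+
    have "K \<noteq> 0" "K \<noteq> 1" using K(1) \<open>P 0\<close> \<open>P 1\<close> by metis+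
    then obtain j where j: "K = Suc (Suc j)" by (metis One_nat_def not0_implies_Suc)
    let ?k = "Suc j"
    obtain v where v: "v \<in> carrier W" "w = v \<otimes> alt (r s) (r t) ?k" "len v + ?k = len w"
      using K(2)[of ?k] j unfolding P_def by auto
    \<comment> \<open>\<open>p\<close> is the letter that would extend the tail and \<open>q\<close>
      its leftmost letter. A descent of \<open>v\<close> at \<open>p\<close> contradicts maximality,
      and one at \<open>q\<close> makes \<open>w\<close> too short.\<close>
    define p q where "p = (if even ?k then t else s)" and "q = (if even ?k then s else t)"
    have pq: "p \<in> S" "q \<in> S" using less.prems(2) t by (auto simp: p_def q_def)
    have "len v < len (v \<otimes> r p)"
    proof (rule ccontr)
      assume "\<not> ?thesis"
      then have "Suc (len (v \<otimes> r p)) = len v" using len_mult_r_less v(1) pq by blast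
      moreover have "w = (v \<otimes> r p) \<otimes> alt (r s) (r t) (Suc ?k)"
        using v pq less.prems(2) t by (cases "even ?k") (simp_all add: p_def m_assoc)
      ultimately have "P (Suc ?k)"
        using v pq unfolding P_def by (intro bexI[of _ "v \<otimes> r p"]) auto
      then show False using K(1) j by simp
    qed
    then have vp: "act1 v (\<alpha> p) \<in> Pos" using less.hyps[of v p] v pq by simp
    have "len v < len (v \<otimes> r q)"
    proof (rule ccontr)
      assume "\<not> ?thesis"
      then have "Suc (len (v \<otimes> r q)) = len v" using len_mult_r_less v(1) pq by blast
      moreover have "w = (v \<otimes> r q) \<otimes> alt (r s) (r t) j"
        using v pq less.prems(2) t by (cases "even ?k") (simp_all add: q_def m_assoc)
      ultimately show False
        using len_mult_alt_le[of "v \<otimes> r q" s t j] v pq less.prems(2) t by simp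
    qed
    then have vq: "act1 v (\<alpha> q) \<in> Pos" using less.hyps[of v q] v pq by simp
    obtain c \<mu> where c: "0 \<le> c" "0 < \<mu>" "- B (\<alpha> s) (\<beta> t) = c * \<mu>" "- B (\<alpha> t) (\<beta> s) * \<mu> = c"
      and cheb: "\<forall>k>0. (\<forall>m. datum_matrix \<alpha> \<beta> B s t = enat m \<longrightarrow> k < m)
           \<longrightarrow> 0 < cheb c k \<and> 0 \<le> cheb c (Suc k)"
      using simple_pair_cheb[OF less.prems(2) t(1) \<open>s \<noteq> t\<close>] .
    have "?k < m" if "datum_matrix \<alpha> \<beta> B s t = enat m" for m
      using not_P[OF that] K(2)[of m] j by (metis Suc_le_eq not_less)
    then have cheb_k: "0 < cheb c ?k" "0 \<le> cheb c (Suc ?k)"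
      using cheb by blast+
    define f where "f = \<mu> *\<^sub>R \<alpha> t"
    have "act1 (alt (r s) (r t) ?k) (\<alpha> s) = cheb c (Suc ?k) *\<^sub>R (if even ?k then \<alpha> s else f)
        + cheb c ?k *\<^sub>R (if even ?k then f else \<alpha> s)"
    proof (rule act1_alt)
      have *: "2 * c * \<mu> = - (2 * B (\<alpha> s) (\<beta> t))" using c(3) by linarith
      show "act1 (r t) (\<alpha> s) = \<alpha> s + (2 * c) *\<^sub>R f"
        by (simp only: act1_simple[OF t(1)] f_def scaleR_scaleR * scaleR_minus_left add_uminus_conv_diff)
      have *: "2 * c = - (2 * (\<mu> * B (\<alpha> t) (\<beta> s)))"
        unfolding c(4)[symmetric] by (simp add: mult.commute)
      show "act1 (r s) f = f + (2 * c) *\<^sub>R \<alpha> s"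
        by (simp only: act1_simple[OF less.prems(2)] f_def B_left * scaleR_minus_left
            add_uminus_conv_diff real_scaleR_def)
      show "act1 (r s) (\<alpha> s) = - \<alpha> s"
        by (rule act1_r_alpha[OF less.prems(2)])
      show "act1 (r t) f = - f"
        using act1_r_alpha[OF t(1)] t(1) by (simp add: f_def act1_linear)
    qed (use less.prems(2) t(1) in auto)
    then have "act1 w (\<alpha> s) = cheb c (Suc ?k) *\<^sub>R act1 v (if even ?k then \<alpha> s else f)
        + cheb c ?k *\<^sub>R act1 v (if even ?k then f else \<alpha> s)"
      using v(1,2) less.prems(2) t(1) by (simp add: act1_mult act1_linear del: alt.simps cheb.simps)
    moreover have "act1 v (if even ?k then \<alpha> s else f) \<in> Pos" "act1 v (if even ?k then f else \<alpha> s) \<in> Pos"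
      using vp vq v(1) c(2) by (auto simp: p_def q_def f_def act1_linear intro: PLC_scaleR)
    ultimately show ?thesis using cheb_k by (auto intro: PLC_combination simp del: cheb.simps)
  qed
qed

lemma Pos_uminus: "x \<in> Pos \<Longrightarrow> - x \<notin> Pos"
  using PLC_add[of x _ "- x"] zero_notin_Pos by auto

lemma Pos_sum_neq_0:
  assumes "x \<in> Pos" "y \<in> Pos" "0 \<le> p" "0 \<le> q" "0 < p \<or> 0 < q"
  shows "p *\<^sub>R x + q *\<^sub>R y \<noteq> 0"
  using PLC_combination[OF assms] zero_notin_Pos by auto

text \<open>The shorter element \<open>w \<otimes> r s\<close> has an ascent at \<open>s\<close>,
  and \<open>r s\<close> negates \<open>\<alpha> s\<close>.\<close>

lemma descent_imp_negative:
  assumes "w \<in> carrier W" "s \<in> S" "\<not> len w < len (w \<otimes> r s)"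
  shows "- act1 w (\<alpha> s) \<in> Pos"
proof -
  have "act1 (w \<otimes> r s) (\<alpha> s) \<in> Pos"
    using len_mult_r_less[OF assms] assms by (intro ascent_imp_positive) auto
  then show ?thesis using assms by (simp add: act1_mult act1_linear act1_r_alpha)
qed

lemma simple_image_sign:
  assumes "w \<in> carrier W" "s \<in> S"
  shows "act1 w (\<alpha> s) \<in> Pos \<or> - act1 w (\<alpha> s) \<in> Pos"
  using ascent_imp_positive[OF assms] descent_imp_negative[OF assms] by blast

lemma root_sign: "x \<in> \<Phi> \<Longrightarrow> x \<in> Pos \<or> - x \<in> Pos"
  unfolding roots_def using simple_image_sign by auto

text \<open>The last letter of a nonempty reduced word is a right descent, so its simple root would
  become negative.\<close>

lemma eq_one_if_preserves_Pos:
  assumes "g \<in> carrier W" "\<And>s. s \<in> S \<Longrightarrow> act1 g (\<alpha> s) \<in> Pos"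
  shows "g = \<one>"
proof -
  obtain u where u: "u \<in> lists S" "length u = len g" "wv u = g"
    using ex_reduced_word[OF assms(1)] .
  show ?thesis
  proof (cases u rule: rev_cases)
    case Nil
    then show ?thesis using u(3) by simp
  next
    case (snoc u' t)
    have t: "t \<in> S" "u' \<in> lists S" using u(1) snoc by auto
    have "g \<otimes> r t = wv u'"
      using wv_snoc[OF t(2,1)] mult_r_r[OF t(1) wv_closed[OF t(2)]] u(3) snoc by simp
    then have "\<not> len g < len (g \<otimes> r t)" using len_le[OF t(2)] u(2) snoc by simp
    then show ?thesis
      using descent_imp_negative[OF assms(1) t(1)] assms(2)[OF t(1)] Pos_uminus by blast
  qed
qed

lemma Pos_extremal_simple:
  assumes "s \<in> S" "z \<in> Pos" "z' \<in> Pos" "z + z' = q *\<^sub>R \<alpha> s"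
  shows "\<exists>l>0. z = l *\<^sub>R \<alpha> s"
  using PLC_extremal[OF zero_notin_Pos _ alpha_notin_PLC[OF assms(1)] assms(2-4)] assms(1) by blast

text \<open>The product of \<open>r s\<close> with the conjugate of \<open>r t\<close> is a transvection along \<open>\<alpha> s\<close>. It preserves the
  positivity of all simple roots, so it is trivial.\<close>

lemma conjugate_simple_eq:
  assumes "s \<in> S" "t \<in> S" "w \<in> carrier W" "0 < l" "act1 w (\<alpha> t) = l *\<^sub>R \<alpha> s"
  shows "w \<otimes> r t \<otimes> inv w = r s"
proof -
  let ?X = "w \<otimes> r t \<otimes> inv w"
  have X: "?X \<in> carrier W" using assms by auto
  have Xv: "act1 ?X v = v - (2 * B v (act2 w (\<beta> t)) * l) *\<^sub>R \<alpha> s" for v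
    using act1_conjugate[OF assms(3,2), of v] assms(5) by simp
  have "B (act1 w (\<alpha> t)) (act2 w (\<beta> t)) = 1"
    using B_invariant[OF assms(3)] pairing_self[OF assms(2)] by simp
  then have "B (\<alpha> s) (act2 w (\<beta> t)) * l = 1"
    using assms(5) by (simp add: B_left mult.commute)
  then have Xs: "act1 ?X (\<alpha> s) = - \<alpha> s"
    using Xv[of "\<alpha> s"] by (simp add: mult.assoc scaleR_2)
  have "r s \<otimes> ?X = \<one>"
  proof (rule eq_one_if_preserves_Pos)
    fix q assume q: "q \<in> S"
    show "act1 (r s \<otimes> ?X) (\<alpha> q) \<in> Pos"
    proof (cases "q = s")
      case True
      have "act1 (r s \<otimes> ?X) (\<alpha> s) = \<alpha> s"
        using Xs X assms(1) by (simp add: act1_mult act1_linear act1_r_alpha)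
      then show ?thesis using True q by simp
    next
      case False
      have "\<exists>k. act1 (r s \<otimes> ?X) (\<alpha> q) = \<alpha> q + k *\<^sub>R \<alpha> s"
      proof -
        have "act1 (r s \<otimes> ?X) (\<alpha> q) = \<alpha> q - (2 * B (\<alpha> q) (act2 w (\<beta> t)) * l) *\<^sub>R \<alpha> s
            - (2 * B (act1 ?X (\<alpha> q)) (\<beta> s)) *\<^sub>R \<alpha> s"
          using X assms(1) Xv[of "\<alpha> q"] by (simp add: act1_mult act1_simple)
        then show ?thesis
          by (intro exI[of _ "- (2 * B (\<alpha> q) (act2 w (\<beta> t)) * l) - 2 * B (act1 ?X (\<alpha> q)) (\<beta> s)"])
            (simp add: scaleR_left_diff_distrib)
      qed
      then obtain k where k: "act1 (r s \<otimes> ?X) (\<alpha> q) = \<alpha> q + k *\<^sub>R \<alpha> s" by blast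
      \<comment> \<open>Otherwise a multiple of \<open>\<alpha> s\<close> would be the sum of
        \<open>\<alpha> q\<close> and a positive vector, and extremality would make
        \<open>\<alpha> q\<close> proportional to \<open>\<alpha> s\<close>.\<close>
      have "- act1 (r s \<otimes> ?X) (\<alpha> q) \<notin> Pos"
      proof
        assume "- act1 (r s \<otimes> ?X) (\<alpha> q) \<in> Pos"
        moreover have "\<alpha> q + - act1 (r s \<otimes> ?X) (\<alpha> q) = (- k) *\<^sub>R \<alpha> s" by (simp add: k)
        ultimately obtain l' where l': "0 < l'" "\<alpha> q = l' *\<^sub>R \<alpha> s"
          using Pos_extremal_simple[OF assms(1)] q alpha_Pos by blast
        have "\<alpha> s \<in> \<alpha> ` S - {\<alpha> q}" using False q assms(1) inj_alpha by (auto dest: inj_onD)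
        then have "\<alpha> q \<in> PLC (\<alpha> ` S - {\<alpha> q})"
          using l' PLC_scaleR[OF PLC_superset l'(1)] by metis
        then show False using alpha_notin_PLC q by blast
      qed
      then show ?thesis using simple_image_sign[OF _ q, of "r s \<otimes> ?X"] X assms(1) by auto
    qed
  qed (use X assms(1) in auto)
  then show ?thesis using r_r_mult[OF assms(1) X] assms(1) by (metis r_in r_one)
qed

text \<open>Translation by \<open>inv v\<close> reduces to a simple root. The factor
  \<open>l\<close> is there because distinct roots can be positive multiples of each other;
  \<open>l = 1\<close> shows that \<open>root_reflection\<close> is well defined.\<close>

lemma proportional_conjugates_eq:
  assumes "s \<in> S" "t \<in> S" "v \<in> carrier W" "w \<in> carrier W" "0 < l"
    and "act1 w (\<alpha> t) = l *\<^sub>R act1 v (\<alpha> s)"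
  shows "w \<otimes> r t \<otimes> inv w = v \<otimes> r s \<otimes> inv v"
proof -
  have "act1 (inv v \<otimes> w) (\<alpha> t) = l *\<^sub>R \<alpha> s"
    using assms by (simp add: act1_mult act1_linear)
  then have "(inv v \<otimes> w) \<otimes> r t \<otimes> inv (inv v \<otimes> w) = r s"
    using assms by (intro conjugate_simple_eq) auto
  then have eq: "inv v \<otimes> (w \<otimes> r t \<otimes> inv w) \<otimes> v = r s"
    using assms by (simp add: inv_mult_group m_assoc)
  have "v \<otimes> (inv v \<otimes> (w \<otimes> r t \<otimes> inv w) \<otimes> v) \<otimes> inv v = w \<otimes> r t \<otimes> inv w"
    using assms by (simp add: m_assoc inv_mult_cancel)
  then show ?thesis unfolding eq by simp
qed

section \<open>Reflections attached to arbitrary roots\<close>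

lemma rfl_act1:
  assumes "w \<in> carrier W" "s \<in> S"
  shows "rfl (act1 w (\<alpha> s)) = w \<otimes> r s \<otimes> inv w"
  unfolding root_reflection_def
proof (rule the_equality)
  show "\<exists>v\<in>carrier W. \<exists>t\<in>S. act1 w (\<alpha> s) = act1 v (\<alpha> t) \<and> w \<otimes> r s \<otimes> inv w = v \<otimes> r t \<otimes> inv v"
    using assms by blast
next
  fix g assume "\<exists>v\<in>carrier W. \<exists>t\<in>S. act1 w (\<alpha> s) = act1 v (\<alpha> t) \<and> g = v \<otimes> r t \<otimes> inv v"
  then obtain v t where "v \<in> carrier W" "t \<in> S" "act1 w (\<alpha> s) = act1 v (\<alpha> t)"
    and g: "g = v \<otimes> r t \<otimes> inv v" by blast
  then show "g = w \<otimes> r s \<otimes> inv w"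
    unfolding g using assms by (intro proportional_conjugates_eq[of s t w v 1]) auto
qed

lemma rootE:
  assumes "x \<in> \<Phi>"
  obtains w s where "w \<in> carrier W" "s \<in> S" "x = act1 w (\<alpha> s)" "rfl x = w \<otimes> r s \<otimes> inv w"
  using assms rfl_act1 unfolding roots_def by auto

lemma alpha_root: "s \<in> S \<Longrightarrow> \<alpha> s \<in> \<Phi>"
  unfolding roots_def by (rule CollectI, rule exI[of _ \<one>], rule exI[of _ s]) auto

lemma act1_root:
  assumes "x \<in> \<Phi>" "g \<in> carrier W"
  shows "act1 g x \<in> \<Phi>" "rfl (act1 g x) = g \<otimes> rfl x \<otimes> inv g"
proof -
  obtain w s where x: "w \<in> carrier W" "s \<in> S" "x = act1 w (\<alpha> s)" "rfl x = w \<otimes> r s \<otimes> inv w"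
    using rootE[OF assms(1)] .
  have gx: "act1 g x = act1 (g \<otimes> w) (\<alpha> s)" using x assms(2) by (simp add: act1_mult)
  then show "act1 g x \<in> \<Phi>" unfolding roots_def using x assms(2) by blast
  show "rfl (act1 g x) = g \<otimes> rfl x \<otimes> inv g"
    unfolding gx x(4) using x(1,2) assms(2) by (simp add: rfl_act1 inv_mult_group m_assoc)
qed

lemma rfl_proportional:
  assumes "x \<in> \<Phi>" "y \<in> \<Phi>" "0 < l" "x = l *\<^sub>R y"
  shows "rfl x = rfl y"
  using rootE[OF assms(1)] rootE[OF assms(2)] proportional_conjugates_eq assms(3,4) by metis

lemma rfl_closed [simp]: "x \<in> \<Phi> \<Longrightarrow> rfl x \<in> carrier W"
  by (erule rootE) auto

lemma rfl_reflection: "x \<in> \<Phi> \<Longrightarrow> rfl x \<in> reflections W S r"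
  by (erule rootE) (auto simp: reflections_def)

lemma rfl_square: "x \<in> \<Phi> \<Longrightarrow> rfl x \<otimes> rfl x = \<one>"
  by (erule rootE) (simp add: m_assoc inv_mult_cancel)

lemma rfl_apply:
  assumes "x \<in> \<Phi>"
  shows "act1 (rfl x) v = v - (2 * B v (\<phi> x)) *\<^sub>R x"
proof -
  obtain w s where x: "w \<in> carrier W" "s \<in> S" "x = act1 w (\<alpha> s)" "rfl x = w \<otimes> r s \<otimes> inv w"
    using rootE[OF assms] .
  then have "\<phi> x = act2 w (\<beta> s)"
    using phi_equivariant[OF x(1) alpha_root[OF x(2)]] phi_simple by simp
  then show ?thesis using act1_conjugate[OF x(1,2), of v] x by simp
qed

lemma B_root_self:
  assumes "x \<in> \<Phi>"
  shows "B x (\<phi> x) = 1"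
proof -
  obtain w s where x: "w \<in> carrier W" "s \<in> S" "x = act1 w (\<alpha> s)" "rfl x = w \<otimes> r s \<otimes> inv w"
    using rootE[OF assms] .
  then show ?thesis
    using phi_equivariant[OF x(1) alpha_root[OF x(2)]] phi_simple B_invariant pairing_self by simp
qed

text \<open>As the letters act from right to left, some letter \<open>s\<close> turns the image of
  \<open>z\<close> from positive to negative. By extremality that image is a positive multiple of
  \<open>\<alpha> s\<close>, so multiplying by \<open>rfl z\<close> deletes this letter.\<close>

lemma strong_exchange:
  assumes "z \<in> \<Phi>" "z \<in> Pos" "u \<in> lists S" "- act1 (wv u) z \<in> Pos"
  shows "\<exists>u'\<in>lists S. length u' < length u \<and> wv u' = wv u \<otimes> rfl z"
  using assms(3,4)
proof (induction u)
  case Nil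
  then show ?case using assms(2) Pos_uminus by simp
next
  case (Cons s u)
  then have s: "s \<in> S" "u \<in> lists S" by auto
  let ?z = "act1 (wv u) z"
  have root: "?z \<in> \<Phi>" using act1_root(1)[OF assms(1)] s by simp
  show ?case
  proof (cases "- ?z \<in> Pos")
    case True
    then obtain u' where "u' \<in> lists S" "length u' < length u" "wv u' = wv u \<otimes> rfl z"
      using Cons.IH s by blast
    then show ?thesis
      using s assms(1) by (intro bexI[of _ "s # u'"]) (auto simp: m_assoc)
  next
    case False
    then have "?z \<in> Pos" using root_sign root by blast
    moreover have "- act1 (r s) ?z \<in> Pos" using Cons.prems s by (simp add: act1_mult)
    moreover have "?z + - act1 (r s) ?z = (2 * B ?z (\<beta> s)) *\<^sub>R \<alpha> s"
      using s by (simp add: act1_simple)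
    ultimately obtain l where "0 < l" "?z = l *\<^sub>R \<alpha> s"
      using Pos_extremal_simple[OF s(1)] by blast
    then have "rfl ?z = rfl (\<alpha> s)" using rfl_proportional[OF root alpha_root] s by blast
    moreover have "rfl (\<alpha> s) = r s" using rfl_act1[of \<one> s] s by simp
    ultimately have "wv u \<otimes> rfl z \<otimes> inv (wv u) = r s"
      using act1_root(2)[OF assms(1)] s by simp
    then have "wv u \<otimes> rfl z = r s \<otimes> wv u"
      using s assms(1) by (simp add: inv_solve_right')
    then have "wv (s # u) \<otimes> rfl z = wv u"
      using s assms(1) by (simp add: m_assoc)
    then show ?thesis using s by (intro bexI[of _ u]) auto
  qed
qed

lemma len_mult_rfl_less:
  assumes "z \<in> \<Phi>" "z \<in> Pos" "w \<in> carrier W" "- act1 w z \<in> Pos"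
  shows "len (w \<otimes> rfl z) < len w"
proof -
  obtain u where u: "u \<in> lists S" "length u = len w" "wv u = w"
    using ex_reduced_word[OF assms(3)] .
  then obtain u' where "u' \<in> lists S" "length u' < length u" "wv u' = wv u \<otimes> rfl z"
    using strong_exchange[OF assms(1,2) u(1)] assms(4) by auto
  then show ?thesis using len_le[of u'] u by simp
qed

end

section \<open>Pairs of canonical roots\<close>

context realization
begin

lemma rfl_self: "x \<in> \<Phi> \<Longrightarrow> act1 (rfl x) x = - x"
  by (simp add: rfl_apply B_root_self scaleR_2)

text \<open>For the last claim: if \<open>z\<close> became negative, then \<open>rfl z\<close> would
  shorten \<open>rfl x\<close> and so lie in \<open>Nbar\<close> of \<open>rfl x\<close> and in
  \<open>H\<close>, where only \<open>rfl x\<close> itself lies.\<close>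

lemma canonical_rootD:
  assumes "x \<in> canonical_roots W S r act1 \<alpha> H"
  shows "x \<in> \<Phi>" "x \<in> Pos" "rfl x \<in> H"
    and "\<And>z. z \<in> \<Phi> \<Longrightarrow> z \<in> Pos \<Longrightarrow> rfl z \<in> H \<Longrightarrow> rfl z \<noteq> rfl x \<Longrightarrow> act1 (rfl x) z \<in> Pos"
proof -
  show x: "x \<in> \<Phi>" "x \<in> Pos"
    using assms by (auto simp: canonical_roots_def positive_roots_def)
  have N: "Nbar W S r (rfl x) \<inter> H = {rfl x}"
    using assms by (simp add: canonical_roots_def canonical_generators_def)
  then show "rfl x \<in> H" by blast
  fix z assume z: "z \<in> \<Phi>" "z \<in> Pos" "rfl z \<in> H" "rfl z \<noteq> rfl x"
  then have "\<not> len (rfl x \<otimes> rfl z) < len (rfl x)"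
    using N rfl_reflection[OF z(1)] unfolding Nbar_def by blast
  then have "- act1 (rfl x) z \<notin> Pos"
    using len_mult_rfl_less[OF z(1,2)] x by auto
  then show "act1 (rfl x) z \<in> Pos"
    using root_sign[OF act1_root(1)[OF z(1) rfl_closed[OF x(1)]]] by blast
qed

end

locale canonical_pair =
  realization S \<alpha> \<beta> B W r act1 act2 \<phi>
  for S :: "'s set"
    and \<alpha> :: "'s \<Rightarrow> 'v1::real_vector"
    and \<beta> :: "'s \<Rightarrow> 'v2::real_vector"
    and B :: "'v1 \<Rightarrow> 'v2 \<Rightarrow> real"
    and W :: "('w, 'm) monoid_scheme" (structure)
    and r :: "'s \<Rightarrow> 'w"
    and act1 :: "'w \<Rightarrow> 'v1 \<Rightarrow> 'v1"
    and act2 :: "'w \<Rightarrow> 'v2 \<Rightarrow> 'v2"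
    and \<phi> :: "'v1 \<Rightarrow> 'v2" +
  fixes H :: "'w set" and x y :: 'v1
  assumes subgroup_H: "subgroup H W"
    and x_canonical: "x \<in> canonical_roots W S r act1 \<alpha> H"
    and y_canonical: "y \<in> canonical_roots W S r act1 \<alpha> H"
    and rfl_neq: "root_reflection W S r act1 \<alpha> x \<noteq> root_reflection W S r act1 \<alpha> y"
begin

abbreviation "\<rho> \<equiv> rfl x"
abbreviation "\<sigma> \<equiv> rfl y"

lemmas x = canonical_rootD[OF x_canonical]
lemmas y = canonical_rootD[OF y_canonical]

lemma swap: "canonical_pair S \<alpha> \<beta> B W r act1 act2 \<phi> H y x"
  by (intro canonical_pair.intro canonical_pair_axioms.intro realization_axioms subgroup_H
      x_canonical y_canonical rfl_neq[symmetric])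

lemma pairing_nonpos_canonical: "B x (\<phi> y) \<le> 0"
proof (rule ccontr)
  define p q where "p = B x (\<phi> y)" and "q = B y (\<phi> x)"
  assume "\<not> B x (\<phi> y) \<le> 0"
  then have p: "0 < p" by (simp add: p_def)
  define z where "z = act1 \<sigma> x"
  have z_eq: "z = x - (2 * p) *\<^sub>R y" using y(1) by (simp add: z_def rfl_apply p_def)
  have z_Pos: "z \<in> Pos" using y(4)[OF x(1-3)] rfl_neq by (simp add: z_def)
  have z_root: "z \<in> \<Phi>" "rfl z = \<sigma> \<otimes> \<rho> \<otimes> inv \<sigma>"
    using act1_root[OF x(1) rfl_closed[OF y(1)]] by (simp_all add: z_def)
  have \<rho>y: "act1 \<rho> y = y - (2 * q) *\<^sub>R x" using x(1) by (simp add: rfl_apply q_def)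
  have \<rho>z: "act1 \<rho> z = (4 * p * q - 1) *\<^sub>R x + (- 2 * p) *\<^sub>R y"
    unfolding z_eq using x(1) by (simp add: act1_linear \<rho>y rfl_self algebra_simps)
  \<comment> \<open>Equality would force \<open>y = q *\<^sub>R x\<close>. Then \<open>q > 0\<close>
    gives equal reflections, and \<open>q \<le> 0\<close> contradicts pointedness of the
    cone.\<close>
  have "rfl z \<noteq> \<rho>"
  proof
    assume "rfl z = \<rho>"
    then have "act1 \<rho> z = - z" using rfl_self[OF z_root(1)] by simp
    moreover have "(p * 4) *\<^sub>R y = (p * 2) *\<^sub>R y + (p * 2) *\<^sub>R y"
      by (simp flip: scaleR_left_distrib)
    ultimately have "(4 * p) *\<^sub>R (q *\<^sub>R x - y) = 0"
      unfolding \<rho>z unfolding z_eq by (simp add: algebra_simps)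
    then have yx: "y = q *\<^sub>R x" using p by simp
    show False
    proof (cases "0 < q")
      case True
      then show False using rfl_proportional[OF y(1) x(1) True yx] rfl_neq by simp
    next
      case False
      then show False using Pos_sum_neq_0[OF y(2) x(2), of 1 "- q"] yx by simp
    qed
  qed
  moreover have "rfl z \<in> H"
    using z_root x(3) y(3) subgroup_H by (simp add: subgroup.m_closed subgroup.m_inv_closed)
  ultimately have \<rho>z_Pos: "act1 \<rho> z \<in> Pos" using x(4) z_root z_Pos by blast
  show False
  proof (cases "4 * p * q \<le> 1")
    case True
    have "(1 - 4 * p * q) *\<^sub>R x + (2 * p) *\<^sub>R y \<in> Pos"
      using x(2) y(2) p True by (intro PLC_combination) auto
    moreover have "- act1 \<rho> z = (1 - 4 * p * q) *\<^sub>R x + (2 * p) *\<^sub>R y"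
      unfolding \<rho>z by (simp add: algebra_simps)
    ultimately show False using Pos_uminus[OF \<rho>z_Pos] by simp
  next
    case False
    \<comment> \<open>Adding \<open>2 * p\<close> times this root to \<open>z\<close> cancels
      \<open>y\<close> and leaves a negative multiple of \<open>x\<close>.\<close>
    have "act1 \<rho> y \<in> Pos" using x(4)[OF y(1-3)] rfl_neq by simp
    then have "1 *\<^sub>R z + (2 * p) *\<^sub>R act1 \<rho> y \<in> Pos"
      using z_Pos p by (intro PLC_combination) auto
    moreover have "1 *\<^sub>R z + (2 * p) *\<^sub>R act1 \<rho> y = - ((4 * p * q - 1) *\<^sub>R x)"
      unfolding z_eq \<rho>y by (simp add: algebra_simps)
    moreover have "(4 * p * q - 1) *\<^sub>R x \<in> Pos" using False x(2) by (intro PLC_scaleR) auto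
    ultimately show False using Pos_uminus by metis
  qed
qed

text \<open>If \<sigma> fixes \<open>x\<close>, then it commutes with \<rho>. Comparing the two
  products on \<open>y\<close> gives \<open>- 2 * q = 2 * q\<close> as coefficients of
  \<open>x\<close>.\<close>

lemma pairing_zero_imp:
  assumes "B x (\<phi> y) = 0"
  shows "B y (\<phi> x) = 0"
proof -
  define q where "q = B y (\<phi> x)"
  have \<sigma>x: "act1 \<sigma> x = x" using y(1) assms by (simp add: rfl_apply)
  then have "\<sigma> \<otimes> \<rho> \<otimes> inv \<sigma> = \<rho>"
    using act1_root(2)[OF x(1) rfl_closed[OF y(1)]] by simp
  then have comm: "\<sigma> \<otimes> \<rho> = \<rho> \<otimes> \<sigma>" using x(1) y(1) by (simp add: inv_solve_right')
  have \<rho>y: "act1 \<rho> y = y - (2 * q) *\<^sub>R x" using x(1) by (simp add: rfl_apply q_def)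
  have "act1 \<sigma> (act1 \<rho> y) = act1 \<rho> (act1 \<sigma> y)"
    using comm x(1) y(1) by (simp flip: act1_mult)
  then have "- ((2 * q) *\<^sub>R x) = (2 * q) *\<^sub>R x"
    using x(1) y(1) by (simp add: \<rho>y \<sigma>x act1_linear rfl_self)
  then have "(2 * q + 2 * q) *\<^sub>R x = 0"
    unfolding scaleR_left_distrib by (metis add.right_inverse)
  then show ?thesis using x(2) zero_notin_Pos by (auto simp: q_def)
qed

section \<open>Alternating products applied to \<open>x\<close>\<close>

lemma alt_in_H: "alt \<rho> \<sigma> k \<in> H"
  using x(3) y(3) subgroup_H
  by (induction k) (auto simp: subgroup.m_closed subgroup.one_closed)

text \<open>The next reflection keeps the current root positive unless it is the reflection in that
  root, which by \<open>alt_conjugate_eq_iff\<close> means that the power with exponent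
  \<open>Suc k\<close> is trivial.\<close>

lemma alt_positive:
  assumes "\<And>j. 0 < j \<Longrightarrow> j \<le> k \<Longrightarrow> (\<rho> \<otimes> \<sigma>) [^] j \<noteq> \<one>"
  shows "act1 (alt \<rho> \<sigma> k) x \<in> Pos"
  using assms
proof (induction k)
  case 0
  then show ?case using x(2) by simp
next
  case (Suc k)
  let ?g = "alt \<rho> \<sigma> k" and ?t = "if even k then y else x"
  have g: "?g \<in> carrier W" using x(1) y(1) by simp
  have Pos: "act1 ?g x \<in> Pos" using Suc by simp
  have root: "act1 ?g x \<in> \<Phi>" "rfl (act1 ?g x) = ?g \<otimes> \<rho> \<otimes> inv ?g"
    using act1_root[OF x(1) g] by auto
  have "rfl (act1 ?g x) \<noteq> (if even k then \<sigma> else \<rho>)"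
    using alt_conjugate_eq_iff[of \<rho> \<sigma> k] Suc.prems[of "Suc k"] x(1) y(1) root(2)
    by (simp only: rfl_closed rfl_square) simp
  moreover have "rfl (act1 ?g x) \<in> H"
    using root(2) alt_in_H x(3) subgroup_H by (simp add: subgroup.m_closed subgroup.m_inv_closed)
  ultimately have "act1 (if even k then \<sigma> else \<rho>) (act1 ?g x) \<in> Pos"
    using x(4)[OF root(1) Pos] y(4)[OF root(1) Pos] by (auto split: if_splits)
  then show ?case using g x(1) y(1) by (simp add: act1_mult)
qed

text \<open>\<open>f\<close> is \<open>y\<close> rescaled so that both reflections have the same
  coefficient \<open>2 * c\<close>. The scale exists because the two pairings vanish
  together.\<close>

lemma scaled_pair:
  obtains c f where "0 \<le> c" "f \<in> Pos" "c\<^sup>2 = B x (\<phi> y) * B y (\<phi> x)"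
    and "\<And>k. act1 (alt \<rho> \<sigma> k) x =
      cheb c (Suc k) *\<^sub>R (if even k then x else f) + cheb c k *\<^sub>R (if even k then f else x)"
proof -
  interpret sw: canonical_pair S \<alpha> \<beta> B W r act1 act2 \<phi> H y x by (rule swap)
  let ?a = "- B x (\<phi> y)" and ?b = "- B y (\<phi> x)"
  have ab: "0 \<le> ?a" "0 \<le> ?b" "?a = 0 \<longleftrightarrow> ?b = 0"
    using pairing_nonpos_canonical sw.pairing_nonpos_canonical pairing_zero_imp sw.pairing_zero_imp
    by auto
  obtain c \<mu> where c: "0 \<le> c" "0 < \<mu>" "?a = c * \<mu>" "?b * \<mu> = c" "c\<^sup>2 = ?a * ?b"
    using symmetrizing_scale[OF ab] .
  define f where "f = \<mu> *\<^sub>R y"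
  have "act1 (alt \<rho> \<sigma> k) x =
      cheb c (Suc k) *\<^sub>R (if even k then x else f) + cheb c k *\<^sub>R (if even k then f else x)" for k
  proof (rule act1_alt)
    have *: "2 * c * \<mu> = - (2 * B x (\<phi> y))" using c(3) by linarith
    show "act1 \<sigma> x = x + (2 * c) *\<^sub>R f"
      by (simp only: rfl_apply[OF y(1)] f_def scaleR_scaleR * scaleR_minus_left add_uminus_conv_diff)
    have *: "2 * c = - (2 * (\<mu> * B y (\<phi> x)))"
      unfolding c(4)[symmetric] by (simp add: mult.commute)
    show "act1 \<rho> f = f + (2 * c) *\<^sub>R x"
      by (simp only: rfl_apply[OF x(1)] f_def B_left * scaleR_minus_left
          add_uminus_conv_diff real_scaleR_def)
    show "act1 \<rho> x = - x" by (rule rfl_self[OF x(1)])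
    show "act1 \<sigma> f = - f" using rfl_self[OF y(1)] y(1) by (simp add: f_def act1_linear)
  qed (use x(1) y(1) in auto)
  moreover have "f \<in> Pos" unfolding f_def using y(2) c(2) by (rule PLC_scaleR)
  ultimately show thesis using that[of c f] c(1,5) by simp
qed

text \<open>Applying \<open>(\<rho> \<sigma>)\<^sup>k = 1\<close>, in the form of a braid relation, to \<open>x\<close> yields a linear relation whose
  coefficients are nonnegative multiples of \<open>cheb c k\<close>, and the positive cone contains no such
  nontrivial relation.\<close>

lemma cheb_eq_0:
  assumes "0 \<le> c" "f \<in> Pos" "0 < k" "(\<rho> \<otimes> \<sigma>) [^] k = \<one>"
    and Z: "\<And>k. act1 (alt \<rho> \<sigma> k) x =
      cheb c (Suc k) *\<^sub>R (if even k then x else f) + cheb c k *\<^sub>R (if even k then f else x)"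
  shows "cheb c k = 0"
proof -
  obtain j where j: "k = Suc j" using assms(3) by (cases k) auto
  have "alt \<rho> \<sigma> (Suc j) = alt \<rho> \<sigma> j \<otimes> \<rho>"
    using alt_braid_iff[of \<rho> \<sigma> k] assms(4) x(1) y(1) j
    by (simp add: rfl_square alt_snoc del: alt.simps)
  then have "act1 (alt \<rho> \<sigma> (Suc j)) x = - act1 (alt \<rho> \<sigma> j) x"
    using x(1) y(1) by (simp add: act1_mult act1_linear rfl_self del: alt.simps)
  then have sum: "act1 (alt \<rho> \<sigma> (Suc j)) x + act1 (alt \<rho> \<sigma> j) x = 0" by simp
  define v where "v = (if even j then 1 *\<^sub>R x + c *\<^sub>R f else 1 *\<^sub>R f + c *\<^sub>R x)"
  have two: "cheb c (Suc (Suc j)) + cheb c j = 2 * cheb c k * c" by (simp add: j)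
  have double: "(2 * cheb c k) *\<^sub>R w = cheb c k *\<^sub>R w + cheb c k *\<^sub>R w" for w :: 'v1
    by (simp flip: scaleR_left_distrib)
  have "act1 (alt \<rho> \<sigma> (Suc j)) x + act1 (alt \<rho> \<sigma> j) x =
      (2 * cheb c k) *\<^sub>R (if even j then x else f)
      + (cheb c (Suc (Suc j)) + cheb c j) *\<^sub>R (if even j then f else x)"
    unfolding Z double by (simp add: j scaleR_left_distrib del: cheb.simps)
  also have "\<dots> = (2 * cheb c k) *\<^sub>R v"
    unfolding two by (simp add: v_def scaleR_right_distrib)
  finally have "(2 * cheb c k) *\<^sub>R v = 0" using sum by simp
  moreover have "v \<noteq> 0"
    unfolding v_def using Pos_sum_neq_0 x(2) assms(1,2) by (auto simp del: scaleR_one)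
  ultimately show ?thesis by simp
qed

lemma pairing_product_canonical:
  defines "n \<equiv> ord (\<rho> \<otimes> \<sigma>)"
  shows "(n = 0 \<and> 1 \<le> B x (\<phi> y) * B y (\<phi> x)) \<or>
    (2 \<le> n \<and> B x (\<phi> y) * B y (\<phi> x) = (cos (pi / real n))\<^sup>2)"
proof -
  obtain c f where c: "0 \<le> c" "f \<in> Pos" "c\<^sup>2 = B x (\<phi> y) * B y (\<phi> x)"
    and Z: "\<And>k. act1 (alt \<rho> \<sigma> k) x =
      cheb c (Suc k) *\<^sub>R (if even k then x else f) + cheb c k *\<^sub>R (if even k then f else x)"
    using scaled_pair by blast
  note cheb_0 = cheb_eq_0[OF c(1,2) _ _ Z]
  have \<rho>\<sigma>: "\<rho> \<otimes> \<sigma> \<in> carrier W" using x(1) y(1) by simp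
  show ?thesis
  proof (cases "1 \<le> c")
    case True
    have "n = 0"
      unfolding n_def ord_eq_0[OF \<rho>\<sigma>]
    proof (intro allI impI notI)
      fix k :: nat assume "k \<noteq> 0" "(\<rho> \<otimes> \<sigma>) [^] k = \<one>"
      then show False using cheb_0[of k] cheb_pos[OF True, of k] by simp
    qed
    moreover have "1 \<le> c\<^sup>2" using True by (simp add: one_le_power)
    ultimately show ?thesis using c(3) by simp
  next
    case False
    define \<theta> where "\<theta> = arccos c"
    have cos: "cos \<theta> = c" unfolding \<theta>_def using c(1) False by (intro cos_arccos) auto
    have \<theta>: "0 < \<theta>" "\<theta> \<le> pi / 2"
      using arccos_less_arccos[of c 1] arccos_le_pi2[of c] c(1) False by (auto simp: \<theta>_def)
    then have \<theta>_pi: "\<theta> < pi" using pi_gt_zero by linarith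
    \<comment> \<open>The first multiple of \<theta> to reach \<open>pi\<close>; it will turn out to
      be the order.\<close>
    define m where "m = (LEAST m. pi \<le> real m * \<theta>)"
    obtain k :: nat where "pi / \<theta> \<le> real k" using real_arch_simple by blast
    then have "pi \<le> real k * \<theta>" using \<theta>(1) by (simp add: divide_le_eq)
    then have m: "pi \<le> real m * \<theta>" unfolding m_def by (rule LeastI)
    have less_m: "real j * \<theta> < pi" if "j < m" for j
      using not_less_Least[of j "\<lambda>m. pi \<le> real m * \<theta>"] that by (simp add: m_def)
    have m2: "2 \<le> m"
    proof (rule ccontr)
      assume "\<not> 2 \<le> m"
      then have "real m * \<theta> \<le> 1 * \<theta>" using \<theta>(1) by (intro mult_right_mono) auto
      then show False using m \<theta>_pi by simp
    qed
    have m_less: "real m * \<theta> < pi + \<theta>"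
      using less_m[of "m - 1"] m2 by (simp add: of_nat_diff algebra_simps)
    have sin_neg: "sin (real m * \<theta>) = - sin (real m * \<theta> - pi)"
      "sin (real (Suc m) * \<theta>) = - sin (real m * \<theta> + \<theta> - pi)"
      by (simp_all add: algebra_simps)
    have sin_\<theta>: "0 < sin \<theta>" using \<theta>(1) \<theta>_pi by (rule sin_gt_zero)
    have "0 \<le> sin (real m * \<theta> - pi)"
      using m m_less \<theta>_pi by (intro sin_ge_zero) linarith+
    then have "cheb c m * sin \<theta> \<le> 0" using cheb_cos[of \<theta> m] sin_neg(1) unfolding cos by linarith
    then have cheb_m: "cheb c m \<le> 0" using sin_\<theta> by (simp add: mult_le_0_iff)
    \<comment> \<open>The argument is below \<open>2 * \<theta>\<close>, and \<theta> is at most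
      \<open>pi / 2\<close> as \<open>c\<close> is nonnegative.\<close>
    have "0 < sin (real m * \<theta> + \<theta> - pi)"
      using m m_less \<theta> by (intro sin_gt_zero) linarith+
    then have "cheb c (Suc m) * sin \<theta> < 0" 
      using cheb_cos[of \<theta> "Suc m"] sin_neg(2) unfolding cos by linarith
    then have cheb_Suc_m: "cheb c (Suc m) < 0" using sin_\<theta> by (simp add: mult_less_0_iff)
    have cheb_0_ge: "m \<le> j" if "0 < j" "cheb c j = 0" for j
      using cheb_cos_pos[OF \<theta>(1) \<theta>_pi that(1)] less_m[of j] that(2) cos by force
    \<comment> \<open>Without such a relation the alternating product of length \<open>m\<close>
      would keep \<open>x\<close> positive, although both its coefficients are nonpositive and one
      is negative.\<close>
    have "\<exists>j. 0 < j \<and> j \<le> m \<and> (\<rho> \<otimes> \<sigma>) [^] j = \<one>"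
    proof (rule ccontr)
      assume "\<not> ?thesis"
      then have "act1 (alt \<rho> \<sigma> m) x \<in> Pos" by (intro alt_positive) auto
      moreover have "- act1 (alt \<rho> \<sigma> m) x = (- cheb c (Suc m)) *\<^sub>R (if even m then x else f)
          + (- cheb c m) *\<^sub>R (if even m then f else x)"
        unfolding Z by (simp del: cheb.simps)
      moreover have "\<dots> \<in> Pos"
        using cheb_m cheb_Suc_m x(2) c(2) by (intro PLC_combination) (auto simp del: cheb.simps)
      ultimately show False using Pos_uminus by metis
    qed
    then obtain j where j: "0 < j" "j \<le> m" "(\<rho> \<otimes> \<sigma>) [^] j = \<one>" by blast
    have "cheb c j = 0" using j(1,3) by (rule cheb_0)
    moreover from this have "j = m" using cheb_0_ge[OF j(1)] j(2) by simp
    ultimately have pow_m: "(\<rho> \<otimes> \<sigma>) [^] m = \<one>" and "cheb c m = 0" using j(3) by simp_all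
    then have sin_0: "sin (real m * \<theta> - pi) = 0"
      using cheb_cos[of \<theta> m] sin_neg(1) unfolding cos by (metis minus_equation_iff minus_zero mult_zero_left)
    have "real m * \<theta> = pi"
    proof (rule ccontr)
      assume "real m * \<theta> \<noteq> pi"
      then have "0 < sin (real m * \<theta> - pi)"
        using m m_less \<theta>_pi by (intro sin_gt_zero) linarith+
      then show False using sin_0 by simp
    qed
    then have "\<theta> = pi / real m" using m2 by (simp add: field_simps)
    moreover have "n = m"
    proof -
      have "n dvd m" using pow_m pow_eq_id[OF \<rho>\<sigma>] by (simp add: n_def)
      then have "0 < n" "n \<le> m" using m2 dvd_pos_nat[of m n] by (auto intro: dvd_imp_le)
      \<comment> \<open>The relation with exponent \<open>n\<close> makes \<open>cheb c n\<close>
        vanish, and no positive index below \<open>m\<close> is a zero.\<close>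
      moreover have "m \<le> n"
        using \<open>0 < n\<close> pow_ord_eq_1[OF \<rho>\<sigma>] unfolding n_def by (intro cheb_0_ge cheb_0)
      ultimately show ?thesis by simp
    qed
    ultimately show ?thesis using m2 cos c(3) by simp
  qed
qed

end

theorem proposition3p22:
  fixes S :: "'s set"
    and \<alpha> :: "'s \<Rightarrow> 'v1::real_vector"
    and \<beta> :: "'s \<Rightarrow> 'v2::real_vector"
    and B :: "'v1 \<Rightarrow> 'v2 \<Rightarrow> real"
    and W :: "('w, 'm) monoid_scheme"
    and r :: "'s \<Rightarrow> 'w"
    and act1 :: "'w \<Rightarrow> 'v1 \<Rightarrow> 'v1"
    and act2 :: "'w \<Rightarrow> 'v2 \<Rightarrow> 'v2"
    and \<phi> :: "'v1 \<Rightarrow> 'v2"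
    and W' :: "'w set"
    and x y :: 'v1
    and n :: nat
  assumes "coxeter_realization S \<alpha> \<beta> B W r act1 act2 \<phi>"
    and "reflection_subgroup W S r W'"
    and "x \<in> canonical_roots W S r act1 \<alpha> W'"
    and "y \<in> canonical_roots W S r act1 \<alpha> W'"
    and "root_reflection W S r act1 \<alpha> x \<noteq> root_reflection W S r act1 \<alpha> y"
    \<comment> \<open>\<open>group.ord\<close> is \<open>0\<close> for elements of infinite order.\<close>
    and "n = group.ord W (root_reflection W S r act1 \<alpha> x \<otimes>\<^bsub>W\<^esub> root_reflection W S r act1 \<alpha> y)"
  shows "B x (\<phi> y) \<le> 0 \<and>
         (n \<ge> 2 \<longrightarrow> B x (\<phi> y) * B y (\<phi> x) = (cos (pi / real n))\<^sup>2) \<and>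
         (n = 0 \<longrightarrow> B x (\<phi> y) * B y (\<phi> x) \<ge> 1)"
proof -
  have "subgroup W' W" using assms(2) by (simp add: reflection_subgroup_def)
  then interpret canonical_pair S \<alpha> \<beta> B W r act1 act2 \<phi> W' x y
    by (intro canonical_pair.intro realization.intro canonical_pair_axioms.intro assms(1,3-5))
  show ?thesis
    using pairing_nonpos_canonical pairing_product_canonical unfolding assms(6) by auto
qed

end
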